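(* Let $\omega$ be a modulus of continuity. There exists a singular inner function $\theta$ such that $$\Lambda^\omega_a \cap K_\theta = \{0\}.$$
   Context: $\mathbb{D} = \{z \in \mathbb{C} : |z|<1\}$ is the unit disk, $\overline{\mathbb{D}}$ its closure, $\mathbb{T}$ the unit circle, and $H^2$ the Hardy space of $\mathbb{D}$. A modulus of continuity is a function $\omega:[0,\infty) \to [0,\infty)$ which is continuous, increasing, satisfies $\omega(0)=0$, and for which $\omega(t)/t$ is a decreasing function (of $t>0$) with $\lim_{t \to 0^+} \omega(t)/t = \infty$. Monotonicity is understood in the non-strict sense. $\Lambda^\omega_a$ is the space of functions $f$ which are analytic in $\mathbb{D}$, extend continuously to $\overline{\mathbb{D}}$, and satisfy $$\sup_{z,w \in \overline{\mathbb{D}},\, z \neq w} \frac{|f(z)-f(w)|}{\omega(|z-w|)} < \infty.$$ A singular inner function is a function of the form $\theta(z) = \exp\big(-\int_{\mathbb{T}} \frac{\zeta+z}{\zeta-z}\, d\nu(\zeta)\big)$, $z \in \mathbb{D}$, where $\nu$ is a non-zero positive finite Borel measure on $\mathbb{T}$ which is singular with respect to Lebesgue measure. For an inner function $\theta$, the model space is $K_\theta = H^2 \ominus \theta H^2$, the orthogonal complement in $H^2$ of the subspace $\theta H^2 = \{\theta h : h \in H^2\}$. *)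

theory Defs
  imports "HOL-Complex_Analysis.Complex_Analysis"
begin

definition modulus_of_continuity :: "(real \<Rightarrow> real) \<Rightarrow> bool" where
  "modulus_of_continuity \<omega> \<longleftrightarrow>
     (\<forall>t\<ge>0. \<omega> t \<ge> 0) \<and>
     continuous_on {0..} \<omega> \<and>
     mono_on {0..} \<omega> \<and>
     \<omega> 0 = 0 \<and>
     antimono_on {0<..} (\<lambda>t. \<omega> t / t) \<and>
     filterlim (\<lambda>t. \<omega> t / t) at_top (at_right 0)"

(* A function on the open unit disk is represented by the total function that
   vanishes outside the disk, so that equality of such functions is HOL equality
   and the zero function is (\<lambda>_. 0). *)
definition disk_analytic :: "(complex \<Rightarrow> complex) set" where
  "disk_analytic = {f. f holomorphic_on ball 0 1 \<and> (\<forall>z. z \<notin> ball 0 1 \<longrightarrow> f z = 0)}"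

(* F is the continuous extension of f to the closed disk; the values of f itself
   on the circle are 0 by convention and carry no information. *)
definition Lambda_a :: "(real \<Rightarrow> real) \<Rightarrow> (complex \<Rightarrow> complex) set" where
  "Lambda_a \<omega> = {f \<in> disk_analytic. \<exists>F. continuous_on (cball 0 1) F \<and>
     (\<forall>z\<in>ball 0 1. F z = f z) \<and>
     bdd_above {cmod (F z - F w) / \<omega> (cmod (z - w)) | z w.
                  z \<in> cball 0 1 \<and> w \<in> cball 0 1 \<and> z \<noteq> w}}"

definition taylor_coeff :: "(complex \<Rightarrow> complex) \<Rightarrow> nat \<Rightarrow> complex" where
  "taylor_coeff f n = (deriv ^^ n) f 0 / fact n"

definition H2 :: "(complex \<Rightarrow> complex) set" where
  "H2 = {f \<in> disk_analytic. summable (\<lambda>n. (cmod (taylor_coeff f n))\<^sup>2)}"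

definition H2_inner :: "(complex \<Rightarrow> complex) \<Rightarrow> (complex \<Rightarrow> complex) \<Rightarrow> complex" where
  "H2_inner f g = (\<Sum>n. taylor_coeff f n * cnj (taylor_coeff g n))"

lemma H2_inner_summable:
  assumes "f \<in> H2" "g \<in> H2"
  shows "summable (\<lambda>n. norm (taylor_coeff f n * cnj (taylor_coeff g n)))"
proof (rule summable_comparison_test)
  show "summable (\<lambda>n. (cmod (taylor_coeff f n))\<^sup>2 + (cmod (taylor_coeff g n))\<^sup>2)"
    using assms by (intro summable_add) (auto simp: H2_def)
  have "a * b \<le> a\<^sup>2 + b\<^sup>2" if "a \<ge> 0" "b \<ge> 0" for a b :: real
  proof -
    have "2 * (a * b) \<le> a\<^sup>2 + b\<^sup>2"
      using sum_squares_bound[of a b] by (simp add: mult.assoc)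
    moreover have "0 \<le> a * b"
      using that by simp
    ultimately show ?thesis
      by linarith
  qed
  then show "\<exists>N. \<forall>n\<ge>N. norm (norm (taylor_coeff f n * cnj (taylor_coeff g n)))
      \<le> (cmod (taylor_coeff f n))\<^sup>2 + (cmod (taylor_coeff g n))\<^sup>2"
    by (simp add: norm_mult)
qed

definition circle_borel :: "complex measure" where
  "circle_borel = restrict_space borel (sphere 0 1)"

definition circle_lebesgue :: "complex measure" where
  "circle_lebesgue = distr (restrict_space lborel {0..<2 * pi}) circle_borel cis"

lemma cis_measurable_circle:
  "cis \<in> measurable (restrict_space lborel {0..<2 * pi}) circle_borel"
proof -
  have "cis \<in> borel_measurable lborel"
    by (simp add: borel_measurable_continuous_onI continuous_on_cis)
  then show ?thesis
    unfolding circle_borel_def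
    by (intro measurable_restrict_space2 measurable_restrict_space1) auto
qed

lemma emeasure_circle_lebesgue_space:
  "emeasure circle_lebesgue (space circle_lebesgue) = ennreal (2 * pi)"
proof -
  have "emeasure circle_lebesgue (space circle_lebesgue) =
      emeasure (restrict_space lborel {0..<2 * pi}) (space (restrict_space lborel {0..<2 * pi}))"
    unfolding circle_lebesgue_def
    using cis_measurable_circle
    by (subst emeasure_distr) (auto intro!: arg_cong2[where f = emeasure] dest: measurable_space)
  also have "\<dots> = ennreal (2 * pi)"
    by (simp add: emeasure_restrict_space space_restrict_space)
  finally show ?thesis .
qed

definition mutually_singular :: "'a measure \<Rightarrow> 'a measure \<Rightarrow> bool" where
  "mutually_singular M N \<longleftrightarrow>
     (\<exists>A \<in> sets M \<inter> sets N. emeasure M (space M - A) = 0 \<and> emeasure N A = 0)"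

definition singular_inner_fun :: "complex measure \<Rightarrow> complex \<Rightarrow> complex" where
  "singular_inner_fun \<nu> z =
     (if z \<in> ball 0 1 then exp (- (LINT \<zeta>|\<nu>. (\<zeta> + z) / (\<zeta> - z))) else 0)"

definition singular_inner :: "(complex \<Rightarrow> complex) \<Rightarrow> bool" where
  "singular_inner \<theta> \<longleftrightarrow> (\<exists>\<nu>. sets \<nu> = sets circle_borel \<and> finite_measure \<nu> \<and>
     emeasure \<nu> (space \<nu>) \<noteq> 0 \<and> mutually_singular \<nu> circle_lebesgue \<and>
     \<theta> = singular_inner_fun \<nu>)"

definition H2_orth_compl :: "(complex \<Rightarrow> complex) set \<Rightarrow> (complex \<Rightarrow> complex) set" where
  "H2_orth_compl S = {f \<in> H2. \<forall>g\<in>S. H2_inner f g = 0}"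

definition model_space :: "(complex \<Rightarrow> complex) \<Rightarrow> (complex \<Rightarrow> complex) set" where
  "model_space \<theta> = H2_orth_compl {\<lambda>z. \<theta> z * h z | h. h \<in> H2}"

end

theory Submission
  imports Defs
begin

text \<open>  The singular measure is chosen so that, on every scale relevant to \<open>\<omega>\<close>, it cannot be told
  apart from a bounded multiple of Lebesgue measure.

  Suppose \<open>f\<close> lies in the model space of \<open>\<theta>\<close>, and let \<open>h\<close> be a bounded analytic multiplier for
  which \<open>\<theta> h\<close> is close to \<open>1\<close> on a disk of radius \<open>r = 1 - t\<close>. Then \<open>f\<close> is orthogonal to
  \<open>G(z) = z^k \<theta>(z) h(z)\<close>. Write \<open>f\<close> as its dilate \<open>f(r z)\<close> plus a remainder. Moving the dilation to the
  other side of the inner product, the dilate pairs with \<open>G(r z)\<close>, which is nearly \<open>(r z)^k\<close>, and so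
  contributes nearly \<open>r^k\<close> times the \<open>k\<close>-th Taylor coefficient of \<open>f\<close>. If \<open>f\<close> has modulus of
  continuity \<open>\<omega>\<close>, the remainder is uniformly of size \<open>\<omega>(t)\<close>, so its pairing with \<open>G\<close> is at most a
  constant times \<open>\<omega>(t) sup|h|\<close>. Hence every Taylor coefficient of \<open>f\<close> vanishes as soon as there are
  multipliers \<open>h\<^sub>n\<close> and scales \<open>t\<^sub>n \<le> 1/2\<close> with \<open>\<theta> h\<^sub>n \<longlonglongrightarrow> 1\<close> uniformly on \<open>|z| \<le> 1 - t\<^sub>n\<close> and
  \<open>\<omega>(t\<^sub>n) sup|h\<^sub>n| \<longlonglongrightarrow> 0\<close>. This is \<open>coefficient_estimate\<close>; all norms in it are controlled by
  the fact that a power series bounded by \<open>M\<close> has coefficients of square sum at most \<open>M\<^sup>2\<close>. The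
  estimate involves \<open>\<omega>(t)\<close> itself and no integral of \<open>\<omega>(t)/t\<close>, so the decay of \<open>\<omega>\<close> may be arbitrarily slow.

  If \<open>\<theta> = exp (- H \<nu>)\<close>, where \<open>H\<close> is the Herglotz integral, the natural choice is \<open>h\<^sub>n = exp (H \<mu>\<^sub>n)\<close> with
  \<open>\<mu>\<^sub>n\<close> an absolutely continuous approximation of \<open>\<nu>\<close>: if the density of \<open>\<mu>\<^sub>n\<close> is at most \<open>n!\<close>, then
  \<open>|h\<^sub>n| \<le> exp (n!)\<close>. So \<open>t\<^sub>n\<close> is dictated by \<open>n!\<close> and \<open>\<omega>\<close>, and what is needed is a singular \<open>\<nu>\<close> whose
  distance from \<open>\<mu>\<^sub>n\<close> is far smaller than \<open>t\<^sub>n\<^sup>2\<close>. Such a \<open>\<nu>\<close> is built by a cascade. Starting from the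
  uniform distribution on a period, step \<open>n\<close> cuts the circle into \<open>N\<^sub>n\<close> equal arcs and squeezes the mass
  of each arc into its initial \<open>1/(n+1)\<close>-th part. This multiplies the density by at most \<open>n + 1\<close> and
  moves no point farther than \<open>1/N\<^sub>n\<close>. Since \<open>\<mu>\<^sub>n\<close> is determined by \<open>N\<^sub>0, \<dots>, N\<^bsub>n-1\<^esub>\<close>, the later
  frequencies are free to grow as fast as \<open>\<omega>\<close> demands. The limit \<open>\<nu>\<close> is singular because
  \<open>\<zeta>^(N\<^sub>n) \<longlonglongrightarrow> 1\<close> at every point of its carrier, whereas for Lebesgue measure this convergence fails
  almost everywhere: averages of the characters \<open>\<zeta>^(N\<^sub>n)\<close> tend to \<open>0\<close> in mean square.\<close>

section \<open>Characters of the circle\<close>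

definition unit_circ :: "real \<Rightarrow> complex" where
  "unit_circ x = cis (2 * pi * x)"

text \<open>The circle is parametrised by \<open>[0, 1)\<close>, with total mass one, so that mean
  values are plain integrals.\<close>

definition period :: "real measure" where
  "period = restrict_space lborel {0..<1}"

lemma space_period [simp]: "space period = {0..<1}"
  by (simp add: period_def space_restrict_space)

lemma emeasure_period [simp]: "emeasure period {0..<1} = 1"
  by (simp add: period_def emeasure_restrict_space)

lemma measure_period [simp]: "measure period {0..<1} = 1"
  by (simp add: measure_def)

lemma finite_measure_period: "finite_measure period"
  by (rule finite_measureI) simp

lemma measurable_period:
  "f \<in> measurable borel M \<Longrightarrow> f \<in> measurable period M"
  unfolding period_def by (intro measurable_restrict_space1) simp

lemma integrable_period_bounded:
  fixes f :: "real \<Rightarrow> 'a :: {banach, second_countable_topology}"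
  assumes "f \<in> borel_measurable borel" "\<And>x. norm (f x) \<le> B"
  shows "integrable period f"
proof -
  interpret finite_measure period by (rule finite_measure_period)
  show ?thesis
    by (rule integrable_const_bound[where B = B]) (use assms measurable_period in auto)
qed

lemma norm_unit_circ [simp]: "cmod (unit_circ x) = 1"
  by (simp add: unit_circ_def)

lemma unit_circ_nonzero [simp]: "unit_circ x \<noteq> 0"
  by (simp add: unit_circ_def)

lemma measurable_unit_circ [measurable]: "unit_circ \<in> borel_measurable borel"
  unfolding unit_circ_def by (intro borel_measurable_continuous_onI continuous_intros)

lemma unit_circ_add_int: "unit_circ (x + of_int m) = unit_circ x"
proof -
  have "cis (2 * pi * of_int m) = 1"
    by (metis cis_multiple_2pi Ints_of_int)
  then show ?thesis
    by (simp add: unit_circ_def algebra_simps flip: cis_mult)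
qed

lemma unit_circ_power: "unit_circ x ^ n = unit_circ (real n * x)"
  by (simp add: unit_circ_def Complex.DeMoivre mult_ac)

lemma dist_unit_circ_le: "cmod (unit_circ x - unit_circ y) \<le> 2 * pi * \<bar>x - y\<bar>"
proof -
  define s t where "s = 2 * pi * x" and "t = 2 * pi * y"
  have "(cmod (cis s - cis t))\<^sup>2 = (cos s - cos t)\<^sup>2 + (sin s - sin t)\<^sup>2"
    by (simp add: cmod_power2)
  also have "\<dots> = 2 - 2 * cos (s - t)"
    using sin_cos_squared_add[of s] sin_cos_squared_add[of t]
    by (simp add: power2_diff cos_diff algebra_simps)
  also have "\<dots> = (2 * sin ((s - t) / 2))\<^sup>2"
    using cos_double_sin[of "(s - t) / 2"] unfolding power_mult_distrib by (simp add: diff_divide_distrib)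
  finally have "cmod (cis s - cis t) = \<bar>2 * sin ((s - t) / 2)\<bar>"
    by (metis abs_norm_cancel real_sqrt_abs)
  also have "\<dots> \<le> \<bar>s - t\<bar>"
    using abs_sin_x_le_abs_x[of "(s - t) / 2"] by simp
  also have "\<dots> = 2 * pi * \<bar>x - y\<bar>"
    by (simp add: s_def t_def abs_mult flip: right_diff_distrib)
  finally show ?thesis by (simp add: unit_circ_def s_def t_def)
qed

text \<open>Cauchy's formula at the centre, read as a Lebesgue integral over a period; it also supplies the
  orthogonality of the characters.\<close>

lemma circle_mean_value:
  assumes "f holomorphic_on cball 0 1"
  shows "(LINT x|period. f (unit_circ x)) = f 0"
proof -
  have cont: "continuous_on UNIV (\<lambda>x. f (unit_circ x))"
  proof (rule continuous_on_compose2[OF holomorphic_on_imp_continuous_on[OF assms]])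
    show "continuous_on UNIV unit_circ"
      unfolding unit_circ_def by (intro continuous_intros)
  qed auto
  have "((\<lambda>u. f u / (u - 0)) has_contour_integral 2 * of_real pi * \<i> * f 0) (circlepath 0 1)"
    by (rule Cauchy_integral_circlepath_simple[OF assms]) simp
  then have "((\<lambda>x. (2 * of_real pi * \<i>) * f (unit_circ x)) has_integral (2 * of_real pi * \<i>) * f 0) {0..1}"
    unfolding has_contour_integral_def
  proof (rule has_integral_eq[rotated])
    fix x :: real assume "x \<in> {0..1}"
    then have "vector_derivative (circlepath 0 1) (at x within {0..1}) = 2 * of_real pi * \<i> * unit_circ x"
      by (simp add: vector_derivative_circlepath01 unit_circ_def cis_conv_exp mult_ac)
    moreover have "circlepath 0 1 x = unit_circ x"
      by (simp add: circlepath unit_circ_def cis_conv_exp mult_ac)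
    ultimately show "f (circlepath 0 1 x) / (circlepath 0 1 x - 0) *
        vector_derivative (circlepath 0 1) (at x within {0..1}) = 2 * of_real pi * \<i> * f (unit_circ x)"
      by simp
  qed
  from has_integral_mult_right[OF this, of "1 / (2 * of_real pi * \<i>)"]
  have "((\<lambda>x. f (unit_circ x)) has_integral f 0) {0..1}"
    by simp
  then have hi: "((\<lambda>x. f (unit_circ x)) has_integral f 0) {0..<1}"
    by (subst has_integral_spike_set_eq[of _ "{0..1}"])
       (auto intro!: negligible_subset[OF negligible_sing[of 1]])
  have si: "set_integrable lborel {0..<1} (\<lambda>x. f (unit_circ x))"
    by (rule set_integrable_subset[OF borel_integrable_atLeastAtMost'[of 0 1]])
       (auto intro: continuous_on_subset[OF cont])
  have "(LINT x|period. f (unit_circ x)) = (LINT x:{0..<1}|lborel. f (unit_circ x))"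
    by (simp add: period_def integral_restrict_space set_lebesgue_integral_def)
  also have "\<dots> = f 0"
    using set_borel_integral_eq_integral(2)[OF si] hi by (simp add: integral_unique)
  finally show ?thesis .
qed

lemma unit_circ_orthogonal:
  "(LINT x|period. unit_circ x ^ j * cnj (unit_circ x ^ k)) = (if j = k then 1 else 0)"
proof -
  interpret finite_measure period by (rule finite_measure_period)
  have *: "(LINT x|period. unit_circ x ^ m) = (if m = 0 then 1 else 0)" for m
    using circle_mean_value[of "\<lambda>u. u ^ m"] by (auto simp: power_0_left holomorphic_on_power)
  have one: "unit_circ x * cnj (unit_circ x) = 1" for x
    by (metis complex_norm_square norm_unit_circ of_real_1 one_power2)
  have split: "unit_circ x ^ (m + l) * cnj (unit_circ x ^ l) = unit_circ x ^ m" for x m l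
  proof -
    have "unit_circ x ^ (m + l) * cnj (unit_circ x ^ l)
        = unit_circ x ^ m * (unit_circ x * cnj (unit_circ x)) ^ l"
      by (simp add: power_add power_mult_distrib)
    then show ?thesis by (simp only: one) simp
  qed
  show ?thesis
  proof (cases "k \<le> j")
    case True
    then show ?thesis using split[of _ "j - k" k] *[of "j - k"] by simp
  next
    case False
    have "(LINT x|period. unit_circ x ^ j * cnj (unit_circ x ^ k))
        = (LINT x|period. cnj (unit_circ x ^ (k - j)))"
    proof (rule Bochner_Integration.integral_cong[OF refl])
      fix x
      show "unit_circ x ^ j * cnj (unit_circ x ^ k) = cnj (unit_circ x ^ (k - j))"
        using arg_cong[OF split[of x "k - j" j], of cnj] False by (simp add: mult_ac)
    qed
    also have "\<dots> = cnj (LINT x|period. unit_circ x ^ (k - j))"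
        by (rule Bochner_Integration.integral_cnj)
    finally show ?thesis using False by (simp add: *)
  qed
qed

lemma trig_polynomial_Parseval:
  assumes "finite J" "inj_on k J"
  shows "(LINT x|period. (cmod (\<Sum>j\<in>J. c j * unit_circ x ^ k j))\<^sup>2) = (\<Sum>j\<in>J. (cmod (c j))\<^sup>2)"
proof -
  let ?p = "\<lambda>x. \<Sum>j\<in>J. c j * unit_circ x ^ k j"
  have int: "integrable period (\<lambda>x. c i * cnj (c j) * (unit_circ x ^ k i * cnj (unit_circ x ^ k j)))" for i j
    by (rule integrable_period_bounded[where B = "cmod (c i) * cmod (c j)"])
       (auto simp: norm_mult norm_power
          intro!: borel_measurable_times borel_measurable_power borel_measurable_continuous_onI
            continuous_intros simp: unit_circ_def)
  have "complex_of_real (LINT x|period. (cmod (?p x))\<^sup>2) = (LINT x|period. ?p x * cnj (?p x))"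
    by (subst integral_complex_of_real[symmetric]) (simp only: complex_norm_square)
  also have "\<dots> = (LINT x|period. (\<Sum>i\<in>J. \<Sum>j\<in>J. c i * cnj (c j) * (unit_circ x ^ k i * cnj (unit_circ x ^ k j))))"
    by (simp add: sum_product mult_ac)
  also have "\<dots> = (\<Sum>i\<in>J. \<Sum>j\<in>J. c i * cnj (c j) * (if k i = k j then 1 else 0))"
    using int by (simp add: Bochner_Integration.integral_sum Bochner_Integration.integrable_sum
        unit_circ_orthogonal del: complex_cnj_power)
  also have "\<dots> = (\<Sum>i\<in>J. \<Sum>j\<in>J. if i = j then c i * cnj (c j) else 0)"
    using assms by (intro sum.cong refl) (auto dest: inj_onD)
  also have "\<dots> = (\<Sum>i\<in>J. c i * cnj (c i))"
    using assms by simp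
  also have "\<dots> = complex_of_real (\<Sum>j\<in>J. (cmod (c j))\<^sup>2)"
    by (simp only: of_real_sum complex_norm_square)
  finally show ?thesis using of_real_eq_iff by blast
qed

section \<open>Bounded power series and the Hardy space\<close>

text \<open>On a circle of radius \<open>r < 1\<close> the power series is a uniform limit of trigonometric polynomials,
  whose square sums are means of squares by Parseval and hence at most about \<open>M\<^sup>2\<close>. Letting \<open>r\<close> tend to
  \<open>1\<close> avoids boundary values altogether.\<close>

lemma bounded_power_series_square_sum:
  assumes sums: "\<And>z. cmod z < 1 \<Longrightarrow> (\<lambda>n. a n * z ^ n) sums g z"
    and bound: "\<And>z. cmod z < 1 \<Longrightarrow> cmod (g z) \<le> M"
  shows "(\<Sum>n<m. (cmod (a n))\<^sup>2) \<le> M\<^sup>2"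
proof -
  interpret finite_measure period by (rule finite_measure_period)
  have "(\<Sum>n<m. (cmod (a n) * r ^ n)\<^sup>2) \<le> M\<^sup>2" if r: "0 < r" "r < 1" for r
  proof -
    (* an auxiliary radius beyond r, where convergence gives absolute convergence at r *)
    define \<rho> where "\<rho> = (1 + r) / 2"
    have "summable (\<lambda>n. a n * of_real \<rho> ^ n)"
      by (rule sums_summable[OF sums]) (use r in \<open>simp add: \<rho>_def del: of_real_add of_real_divide\<close>)
    then have abs: "summable (\<lambda>n. cmod (a n * of_real r ^ n))"
      by (rule powser_insidea) (use r in \<open>auto simp: \<rho>_def simp del: of_real_add of_real_divide\<close>)
    define S where "S = (\<Sum>n. cmod (a n * of_real r ^ n))"
    define T where "T m = S - (\<Sum>n<m. cmod (a n * of_real r ^ n))" for m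
    have tail: "cmod (\<Sum>n<m. (a n * of_real r ^ n) * unit_circ x ^ n) \<le> M + T m" for m x
    proof -
      let ?z = "of_real r * unit_circ x"
      have z: "cmod ?z < 1" using r by (simp add: norm_mult)
      have nrm: "cmod (a n * ?z ^ n) = cmod (a n * of_real r ^ n)" for n
        by (simp add: norm_mult norm_power)
      have sm: "summable (\<lambda>n. cmod (a (n + m) * ?z ^ (n + m)))"
        using summable_ignore_initial_segment[OF abs, of m] by (simp only: nrm)
      have "g ?z - (\<Sum>n<m. a n * ?z ^ n) = (\<Sum>n. a (n + m) * ?z ^ (n + m))"
        using suminf_minus_initial_segment[OF sums_summable[OF sums[OF z]], of m]
          sums_unique[OF sums[OF z]] by simp
      also have "cmod \<dots> \<le> (\<Sum>n. cmod (a (n + m) * ?z ^ (n + m)))"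
        by (rule summable_norm[OF sm])
      also have "\<dots> = T m"
        unfolding nrm T_def S_def using suminf_minus_initial_segment[OF abs, of m] by simp
      finally have "cmod (g ?z - (\<Sum>n<m. a n * ?z ^ n)) \<le> T m" .
      moreover have "cmod (\<Sum>n<m. a n * ?z ^ n)
          \<le> cmod (g ?z) + cmod (g ?z - (\<Sum>n<m. a n * ?z ^ n))"
        by (metis norm_triangle_sub add.commute norm_minus_commute)
      ultimately have "cmod (\<Sum>n<m. a n * ?z ^ n) \<le> M + T m"
        using bound[OF z] by linarith
      then show ?thesis by (simp add: power_mult_distrib mult_ac)
    qed
    have le: "(\<Sum>n<m. (cmod (a n) * r ^ n)\<^sup>2) \<le> (M + T l)\<^sup>2" if "m \<le> l" for l
    proof -
      let ?p = "\<lambda>x. \<Sum>n<l. (a n * of_real r ^ n) * unit_circ x ^ n"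
      have sq: "(cmod (?p x))\<^sup>2 \<le> (M + T l)\<^sup>2" for x
        by (rule power_mono[OF tail]) simp
      have "(\<Sum>n<m. (cmod (a n) * r ^ n)\<^sup>2) \<le> (\<Sum>n<l. (cmod (a n) * r ^ n)\<^sup>2)"
        using that by (intro sum_mono2) auto
      also have "\<dots> = (LINT x|period. (cmod (?p x))\<^sup>2)"
        using r by (subst trig_polynomial_Parseval) (auto simp: norm_mult norm_power)
      also have "\<dots> \<le> (LINT x|period. (M + T l)\<^sup>2)"
      proof (rule integral_mono)
        show "integrable period (\<lambda>x. (cmod (?p x))\<^sup>2)"
          by (rule integrable_period_bounded[where B = "(M + T l)\<^sup>2"]) (use sq in auto)
      qed (use sq in auto)
      finally show ?thesis by simp
    qed
    have "T \<longlonglongrightarrow> S - S"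
      unfolding T_def S_def by (intro tendsto_intros summable_LIMSEQ abs)
    then have "(\<lambda>l. (M + T l)\<^sup>2) \<longlonglongrightarrow> (M + (S - S))\<^sup>2"
      by (intro tendsto_intros)
    then show ?thesis
      using le by (intro LIMSEQ_le_const) auto
  qed
  note * = this
  have "((\<lambda>r. \<Sum>n<m. (cmod (a n) * r ^ n)\<^sup>2) \<longlongrightarrow> (\<Sum>n<m. (cmod (a n) * 1 ^ n)\<^sup>2)) (at_left 1)"
    by (intro tendsto_intros)
  moreover have "eventually (\<lambda>r. (\<Sum>n<m. (cmod (a n) * r ^ n)\<^sup>2) \<le> M\<^sup>2) (at_left 1)"
    using eventually_at_left_real[OF zero_less_one] by eventually_elim (use * in auto)
  ultimately show ?thesis
    using tendsto_upperbound[of _ _ "at_left (1::real)"] by fastforce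
qed

lemma Cauchy_Schwarz_partial_sum:
  fixes a b :: "nat \<Rightarrow> complex"
  assumes a: "(\<Sum>n<m. (cmod (a n))\<^sup>2) \<le> A\<^sup>2" and b: "(\<Sum>n<m. (cmod (b n))\<^sup>2) \<le> B\<^sup>2"
    and AB: "0 \<le> A" "0 \<le> B"
  shows "cmod (\<Sum>n<m. a n * cnj (b n)) \<le> A * B"
proof -
  have "cmod (\<Sum>n<m. a n * cnj (b n)) \<le> (\<Sum>n<m. \<bar>cmod (a n)\<bar> * \<bar>cmod (b n)\<bar>)"
    by (rule order_trans[OF norm_sum]) (simp add: norm_mult)
  also have "\<dots> \<le> L2_set (\<lambda>n. cmod (a n)) {..<m} * L2_set (\<lambda>n. cmod (b n)) {..<m}"
    by (rule L2_set_mult_ineq)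
  also have "\<dots> \<le> A * B"
    unfolding L2_set_def using a b AB
    by (intro mult_mono real_le_lsqrt) (auto intro: sum_nonneg)
  finally show ?thesis .
qed

text \<open>This is where the orthogonality of \<open>f\<close> and \<open>G\<close> is converted into smallness of a coefficient of \<open>f\<close>.
  Termwise, \<open>a\<^sub>n b\<^sub>n\<^sup>*\<close> (with \<open>*\<close> for conjugation) equals
  \<open>a\<^sub>n (r^n b\<^sub>n)\<^sup>* + a\<^sub>n (1 - r^n) b\<^sub>n\<^sup>*\<close>. In the first product the numbers \<open>r^n b\<^sub>n\<close> are the coefficients of
  \<open>G(r z)\<close>, close to those of \<open>(r z)^k\<close>; in the second, \<open>a\<^sub>n (1 - r^n)\<close> are the coefficients of
  \<open>f(z) - f(r z)\<close>. Cauchy-Schwarz then needs only suprema over the open disk.\<close>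

lemma coefficient_estimate:
  fixes f G :: "complex \<Rightarrow> complex"
  assumes f: "\<And>z. cmod z < 1 \<Longrightarrow> (\<lambda>n. a n * z ^ n) sums f z"
    and G: "\<And>z. cmod z < 1 \<Longrightarrow> (\<lambda>n. b n * z ^ n) sums G z"
    and r: "0 \<le> r" "r < 1"
    and dilate: "\<And>z. cmod z < 1 \<Longrightarrow> cmod (f z - f (of_real r * z)) \<le> E"
    and bound: "\<And>z. cmod z < 1 \<Longrightarrow> cmod (G z) \<le> B"
    and near: "\<And>z. cmod z < 1 \<Longrightarrow> cmod (G (of_real r * z) - (of_real r * z) ^ k) \<le> \<epsilon>"
    and F: "\<And>m. (\<Sum>n<m. (cmod (a n))\<^sup>2) \<le> F\<^sup>2" "0 \<le> F"
    and orth: "(\<lambda>n. a n * cnj (b n)) sums 0"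
  shows "r ^ k * cmod (a k) \<le> F * \<epsilon> + E * B"
proof -
  have pos: "0 \<le> E" "0 \<le> B" "0 \<le> \<epsilon>"
    using order_trans[OF norm_ge_zero dilate[of 0]] order_trans[OF norm_ge_zero bound[of 0]]
      order_trans[OF norm_ge_zero near[of 0]] by simp_all
  have rz: "cmod (of_real r * z) < 1" if "cmod z < 1" for z
    using that r mult_le_less_imp_less[of r 1 "cmod z" 1]
    by (cases "r = 0") (auto simp: norm_mult intro: le_less_trans[OF mult_left_le_one_le])
  define c where "c n = a n * (1 - of_real r ^ n)" for n
  define d where "d n = b n * of_real r ^ n - (if n = k then of_real r ^ k else 0)" for n
  have "(\<lambda>n. c n * z ^ n) sums (f z - f (of_real r * z))" if "cmod z < 1" for z
    using sums_diff[OF f[OF that] f[OF rz[OF that]]]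
    by (simp add: c_def power_mult_distrib algebra_simps)
  then have c: "(\<Sum>n<m. (cmod (c n))\<^sup>2) \<le> E\<^sup>2" for m
    by (rule bounded_power_series_square_sum) (use dilate in auto)
  have "(\<lambda>n. d n * z ^ n) sums (G (of_real r * z) - (of_real r * z) ^ k)" if "cmod z < 1" for z
  proof -
    have "(\<lambda>n. b n * (of_real r * z) ^ n - (if n = k then (of_real r * z) ^ n else 0))
        sums (G (of_real r * z) - (of_real r * z) ^ k)"
      by (intro sums_diff G rz that sums_single)
    moreover have "b n * (of_real r * z) ^ n - (if n = k then (of_real r * z) ^ n else 0) = d n * z ^ n" for n
      by (simp add: d_def power_mult_distrib algebra_simps)
    ultimately show ?thesis by simp
  qed
  then have d: "(\<Sum>n<m. (cmod (d n))\<^sup>2) \<le> \<epsilon>\<^sup>2" for m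
    by (rule bounded_power_series_square_sum) (use near in auto)
  have b: "(\<Sum>n<m. (cmod (b n))\<^sup>2) \<le> B\<^sup>2" for m
    by (rule bounded_power_series_square_sum[OF G bound])
  have split: "a n * cnj (b n) - (if n = k then a n * of_real r ^ k else 0)
      = a n * cnj (d n) + c n * cnj (b n)" for n
    by (simp add: c_def d_def algebra_simps)
  have "(\<lambda>n. a n * cnj (d n) + c n * cnj (b n)) sums (0 - a k * of_real r ^ k)"
    unfolding split[symmetric] by (intro sums_diff orth sums_single)
  moreover have "cmod (\<Sum>n<m. a n * cnj (d n) + c n * cnj (b n)) \<le> F * \<epsilon> + E * B" for m
    unfolding sum.distrib
    by (intro order_trans[OF norm_triangle_ineq] add_mono Cauchy_Schwarz_partial_sum F c d b pos)
  ultimately have "cmod (0 - a k * of_real r ^ k) \<le> F * \<epsilon> + E * B"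
    unfolding sums_def by (intro LIMSEQ_le_const2[OF tendsto_norm]) auto
  then show ?thesis using r by (simp add: norm_mult norm_power mult.commute)
qed

lemma taylor_coeff_sums:
  assumes "f holomorphic_on ball 0 1" "cmod z < 1"
  shows "(\<lambda>n. taylor_coeff f n * z ^ n) sums f z"
  using holomorphic_power_series[of f 0 1 z] assms by (simp add: taylor_coeff_def)

lemma bounded_disk_analytic_in_H2:
  assumes f: "f \<in> disk_analytic" and bound: "\<And>z. cmod z < 1 \<Longrightarrow> cmod (f z) \<le> M"
  shows "f \<in> H2"
proof -
  have "f holomorphic_on ball 0 1" using f by (simp add: disk_analytic_def)
  then have "(\<Sum>n<m. (cmod (taylor_coeff f n))\<^sup>2) \<le> M\<^sup>2" for m
    using bound by (intro bounded_power_series_square_sum[of _ f] taylor_coeff_sums)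
  then have "summable (\<lambda>n. (cmod (taylor_coeff f n))\<^sup>2)"
    by (intro summableI_nonneg_bounded) auto
  then show ?thesis using f by (simp add: H2_def)
qed

section \<open>Herglotz integrals\<close>

text \<open>The Herglotz integral of the distribution of \<open>u\<close> under the uniform measure on a period. Working with
  maps in place of their image measures lets two measures be compared pointwise.\<close>

definition herglotz :: "(real \<Rightarrow> complex) \<Rightarrow> complex \<Rightarrow> complex" where
  "herglotz u z = (LINT x|period. (u x + z) / (u x - z))"

lemma herglotz_kernel_sums:
  assumes "cmod \<zeta> = 1" "cmod z < 1"
  shows "(\<lambda>n. (if n = 0 then 1 else 2) * cnj \<zeta> ^ n * z ^ n) sums ((\<zeta> + z) / (\<zeta> - z))"
proof -
  define w where "w = cnj \<zeta> * z"
  have unit: "\<zeta> * cnj \<zeta> = 1" "\<zeta> \<noteq> 0"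
    using complex_norm_square[of \<zeta>] assms by auto
  have w: "cmod w < 1" using assms by (simp add: w_def norm_mult)
  have "\<zeta> * w = z"
    unfolding w_def by (metis unit(1) mult.assoc mult_1)
  then have "\<zeta> + z = \<zeta> * (1 + w)" "\<zeta> - z = \<zeta> * (1 - w)"
    by (simp_all add: distrib_left right_diff_distrib)
  then have "(\<zeta> + z) / (\<zeta> - z) = (1 + w) / (1 - w)" using unit by simp
  also have "\<dots> = 2 * (1 / (1 - w)) - 1"
  proof -
    have "1 - w \<noteq> 0" using w by auto
    then show ?thesis by (simp add: divide_simps)
  qed
  finally have "(\<zeta> + z) / (\<zeta> - z) = 2 * (1 / (1 - w)) - 1" .
  moreover have "(\<lambda>n. 2 * w ^ n - (if n = 0 then 1 else 0)) sums (2 * (1 / (1 - w)) - 1)"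
    using sums_single[of 0 "\<lambda>_. 1 :: complex"]
    by (intro sums_diff sums_mult geometric_sums w)
  moreover have "2 * w ^ n - (if n = 0 then 1 else 0) = (if n = 0 then 1 else 2) * cnj \<zeta> ^ n * z ^ n" for n
    by (simp add: w_def power_mult_distrib)
  ultimately show ?thesis by simp
qed

lemma norm_diff_unit_ge:
  assumes "cmod \<zeta> = 1" shows "1 - cmod z \<le> cmod (\<zeta> - z)"
  using norm_triangle_ineq2[of \<zeta> z] assms by simp

lemma norm_herglotz_kernel_le:
  assumes "cmod \<zeta> = 1" "cmod z < 1"
  shows "cmod ((\<zeta> + z) / (\<zeta> - z)) \<le> 2 / (1 - cmod z)"
  unfolding norm_divide using assms norm_diff_unit_ge[of \<zeta> z] norm_triangle_ineq[of \<zeta> z]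
  by (intro frac_le) auto

lemma Re_herglotz_kernel_nonneg:
  assumes "cmod \<zeta> = 1" "cmod z < 1"
  shows "0 \<le> Re ((\<zeta> + z) / (\<zeta> - z))"
proof -
  have "Re ((\<zeta> + z) * cnj (\<zeta> - z)) = (cmod \<zeta>)\<^sup>2 - (cmod z)\<^sup>2"
    unfolding cmod_power2 by (simp add: algebra_simps power2_eq_square)
  also have "\<dots> \<ge> 0" using assms by (simp add: power_le_one)
  finally show ?thesis by (simp add: complex_div_cnj[of "\<zeta> + z"] zero_le_divide_iff)
qed

lemma herglotz_kernel_Lipschitz:
  assumes "cmod \<zeta> = 1" "cmod \<xi> = 1" "cmod z < 1"
  shows "cmod ((\<zeta> + z) / (\<zeta> - z) - (\<xi> + z) / (\<xi> - z)) \<le> 2 * cmod (\<zeta> - \<xi>) / (1 - cmod z)\<^sup>2"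
proof -
  have nz: "\<zeta> - z \<noteq> 0" "\<xi> - z \<noteq> 0" using assms by auto
  then have "(\<zeta> + z) / (\<zeta> - z) - (\<xi> + z) / (\<xi> - z) = - (2 * z * (\<zeta> - \<xi>)) / ((\<zeta> - z) * (\<xi> - z))"
    by (simp add: divide_simps) (simp add: algebra_simps)
  then have "cmod ((\<zeta> + z) / (\<zeta> - z) - (\<xi> + z) / (\<xi> - z))
      = 2 * cmod z * cmod (\<zeta> - \<xi>) / (cmod (\<zeta> - z) * cmod (\<xi> - z))"
    by (simp add: norm_divide norm_mult)
  also have "\<dots> \<le> 2 * cmod (\<zeta> - \<xi>) / ((1 - cmod z) * (1 - cmod z))"
    using assms norm_diff_unit_ge[of \<zeta> z] norm_diff_unit_ge[of \<xi> z]
    by (intro frac_le mult_mono mult_pos_pos) (auto intro: mult_left_le_one_le)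
  finally show ?thesis by (simp add: power2_eq_square)
qed

context
  fixes u :: "real \<Rightarrow> complex"
  assumes meas [measurable]: "u \<in> borel_measurable borel" and unit: "\<And>x. cmod (u x) = 1"
begin

lemma integrable_herglotz_kernel:
  assumes "cmod z < 1"
  shows "integrable period (\<lambda>x. (u x + z) / (u x - z))"
  by (rule integrable_period_bounded[where B = "2 / (1 - cmod z)"])
     (use assms norm_herglotz_kernel_le unit in auto)

text \<open>Integrating the power series of the kernel termwise yields analyticity although \<open>u\<close> is merely
  measurable.\<close>

lemma herglotz_sums:
  assumes z: "cmod z < 1"
  shows "(\<lambda>n. (if n = 0 then 1 else 2) * (LINT x|period. cnj (u x) ^ n) * z ^ n) sums herglotz u z"
proof -
  let ?f = "\<lambda>n x. (if n = 0 then 1 else 2) * cnj (u x) ^ n * z ^ n"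
  have bound: "cmod (?f n x) \<le> 2 * cmod z ^ n" for n x
    by (simp add: norm_mult norm_power unit)
  have geo: "summable (\<lambda>n. 2 * cmod z ^ n)"
    using z by (intro summable_mult summable_geometric) simp
  have meas_cnj [measurable]: "(\<lambda>x. cnj (u x)) \<in> borel_measurable borel"
    by (rule borel_measurable_continuous_on[OF _ meas]) (intro continuous_intros)
  have int: "integrable period (?f n)" for n
    by (rule integrable_period_bounded[where B = "2 * cmod z ^ n"]) (use bound in auto)
  interpret finite_measure period by (rule finite_measure_period)
  have "(\<lambda>n. integral\<^sup>L period (?f n)) sums (LINT x|period. (\<Sum>n. ?f n x))"
  proof (rule sums_integral[OF int])
    show "AE x in period. summable (\<lambda>n. norm (?f n x))"
      by (intro AE_I2 summable_comparison_test'[OF geo, of 0]) (use bound in simp)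
    have "(LINT x|period. norm (?f n x)) \<le> (LINT x|period. 2 * cmod z ^ n)" for n
      by (intro integral_mono integrable_norm int bound) auto
    then show "summable (\<lambda>n. LINT x|period. norm (?f n x))"
      by (intro summable_comparison_test'[OF geo, of 0]) simp
  qed
  moreover have "(LINT x|period. (\<Sum>n. ?f n x)) = herglotz u z"
    unfolding herglotz_def
    using sums_unique[OF herglotz_kernel_sums[OF unit z]] by simp
  ultimately show ?thesis by simp
qed

lemma herglotz_holomorphic: "herglotz u holomorphic_on ball 0 1"
  by (rule power_series_holomorphic) (use herglotz_sums in simp)

lemma Re_herglotz: "cmod z < 1 \<Longrightarrow> Re (herglotz u z) = (LINT x|period. Re ((u x + z) / (u x - z)))"
  unfolding herglotz_def using integral_Re[OF integrable_herglotz_kernel] by simp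

lemma Re_herglotz_nonneg: "cmod z < 1 \<Longrightarrow> 0 \<le> Re (herglotz u z)"
  by (simp add: Re_herglotz Re_herglotz_kernel_nonneg unit del: Re_divide)

end

text \<open>Coupling two measures through a common parameter bounds the difference of their Herglotz
  integrals by the Lipschitz constant of the kernel, which is of the order of the inverse square of the
  distance to the circle.\<close>

lemma herglotz_dist_le:
  assumes u: "u \<in> borel_measurable borel" "\<And>x. cmod (u x) = 1"
    and v: "v \<in> borel_measurable borel" "\<And>x. cmod (v x) = 1"
    and close: "\<And>x. cmod (u x - v x) \<le> \<delta>" and z: "cmod z < 1"
  shows "cmod (herglotz u z - herglotz v z) \<le> 2 * \<delta> / (1 - cmod z)\<^sup>2"
proof -
  interpret finite_measure period by (rule finite_measure_period)
  have "herglotz u z - herglotz v z = (LINT x|period. (u x + z) / (u x - z) - (v x + z) / (v x - z))"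
    unfolding herglotz_def
    by (intro Bochner_Integration.integral_diff[symmetric] integrable_herglotz_kernel u v z)
  also have "cmod \<dots> \<le> (LINT x|period. 2 * \<delta> / (1 - cmod z)\<^sup>2)"
  proof (rule Bochner_Integration.integral_norm_bound_integral)
    show "integrable period (\<lambda>x. (u x + z) / (u x - z) - (v x + z) / (v x - z))"
      by (intro Bochner_Integration.integrable_diff integrable_herglotz_kernel u v z)
    fix x
    show "cmod ((u x + z) / (u x - z) - (v x + z) / (v x - z)) \<le> 2 * \<delta> / (1 - cmod z)\<^sup>2"
      by (rule order_trans[OF herglotz_kernel_Lipschitz[OF u(2) v(2) z]])
         (use close[of x] in \<open>auto intro!: divide_right_mono\<close>)
  qed simp
  finally show ?thesis by simp
qed

lemma herglotz_unit_circ: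
  assumes "cmod z < 1" shows "herglotz unit_circ z = 1"
proof -
  have "(LINT x|period. cnj (unit_circ x) ^ n) = (if n = 0 then 1 else 0)" for n
    using unit_circ_orthogonal[of 0 n] by simp
  then have "(if n = 0 then 1 else 2) * (LINT x|period. cnj (unit_circ x) ^ n) * z ^ n
      = (if n = 0 then 1 else 0)" for n
    by simp
  then have "(\<lambda>n. if n = 0 then 1 else 0) sums herglotz unit_circ z"
    using herglotz_sums[of unit_circ z] assms by simp
  then show ?thesis
    using sums_single[of 0 "\<lambda>_. 1 :: complex"] sums_unique2 by blast
qed

text \<open>The real part of a Herglotz integral is the Poisson integral, an average of the density. The
  hypothesis on \<open>\<phi>\<close> says that the image of the uniform measure under \<open>\<phi>\<close> has density at most \<open>C\<close>.\<close>

lemma Re_herglotz_le_density: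
  assumes \<phi> [measurable]: "\<phi> \<in> borel_measurable borel" and "0 \<le> C"
    and dens: "\<And>g. g \<in> borel_measurable borel \<Longrightarrow>
      (\<integral>\<^sup>+ x. g (\<phi> x) \<partial>period) \<le> ennreal C * (\<integral>\<^sup>+ x. g x \<partial>period)"
    and z: "cmod z < 1"
  shows "Re (herglotz (\<lambda>x. unit_circ (\<phi> x)) z) \<le> C"
proof -
  let ?P = "\<lambda>x. Re ((unit_circ x + z) / (unit_circ x - z))"
  have pos: "0 \<le> ?P x" for x by (rule Re_herglotz_kernel_nonneg) (use z in auto)
  have meas [measurable]: "?P \<in> borel_measurable borel" by measurable
  have u: "(\<lambda>x. unit_circ (\<phi> x)) \<in> borel_measurable borel" by measurable
  have int: "integrable period (\<lambda>x. ?P (\<phi> x))"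
    by (intro integrable_Re integrable_herglotz_kernel[of "\<lambda>x. unit_circ (\<phi> x)", OF u _ z]) simp
  have int1: "integrable period ?P"
    by (intro integrable_Re integrable_herglotz_kernel[of unit_circ, OF _ _ z]) auto
  have "ennreal (Re (herglotz (\<lambda>x. unit_circ (\<phi> x)) z)) = ennreal (LINT x|period. ?P (\<phi> x))"
    using Re_herglotz[of "\<lambda>x. unit_circ (\<phi> x)" z] u z by (simp del: Re_divide)
  also have "\<dots> = (\<integral>\<^sup>+ x. ennreal (?P (\<phi> x)) \<partial>period)"
    using int pos by (intro nn_integral_eq_integral[symmetric]) (auto simp del: Re_divide)
  also have "\<dots> \<le> ennreal C * (\<integral>\<^sup>+ x. ennreal (?P x) \<partial>period)"
    by (rule dens[of "\<lambda>y. ennreal (?P y)"]) measurable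
  also have "(\<integral>\<^sup>+ x. ennreal (?P x) \<partial>period) = ennreal (LINT x|period. ?P x)"
    using int1 pos by (intro nn_integral_eq_integral) (auto simp del: Re_divide)
  also have "(LINT x|period. ?P x) = 1"
    using Re_herglotz[of unit_circ z] z herglotz_unit_circ[OF z] by (simp del: Re_divide)
  finally show ?thesis using \<open>0 \<le> C\<close> by simp
qed

section \<open>The cascade\<close>

text \<open>Each cell \<open>[j/N, (j+1)/N)\<close> is contracted by the factor \<open>s\<close> towards its left end point.\<close>

definition compress :: "nat \<Rightarrow> real \<Rightarrow> real \<Rightarrow> real" where
  "compress N s x = (of_int \<lfloor>real N * x\<rfloor> + frac (real N * x) / s) / real N"

lemma measurable_compress [measurable]: "compress N s \<in> borel_measurable borel"
  unfolding compress_def frac_def by measurable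

lemma divide_ge_one_le:
  fixes a s :: real
  assumes "0 \<le> a" "1 \<le> s"
  shows "0 \<le> a / s \<and> a / s \<le> a"
  using divide_left_mono[of 1 s a] assms by auto

lemma compress_dist_le:
  assumes "N \<ge> 1" "s \<ge> 1"
  shows "\<bar>compress N s x - x\<bar> \<le> 1 / real N"
proof -
  have "x = (of_int \<lfloor>real N * x\<rfloor> + frac (real N * x)) / real N"
    using assms by (simp add: frac_def)
  then have "compress N s x - x = (frac (real N * x) / s - frac (real N * x)) / real N"
    unfolding compress_def by (simp add: diff_divide_distrib add_divide_distrib)
  also have "\<bar>\<dots>\<bar> \<le> 1 / real N"
  proof -
    have "0 \<le> frac (real N * x) / s" "frac (real N * x) / s \<le> frac (real N * x)" "frac (real N * x) < 1"
      using divide_ge_one_le[of "frac (real N * x)" s] assms frac_lt_1[of "real N * x"] by auto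
    then show ?thesis by (simp add: abs_divide divide_right_mono)
  qed
  finally show ?thesis .
qed

lemma compress_near_grid:
  assumes "N \<ge> 1" "s > 0"
  shows "\<exists>m::int. \<bar>real N * compress N s x - of_int m\<bar> \<le> 1 / s"
proof
  show "\<bar>real N * compress N s x - of_int \<lfloor>real N * x\<rfloor>\<bar> \<le> 1 / s"
    using assms frac_ge_0[of "real N * x"] frac_lt_1[of "real N * x"]
    by (simp add: compress_def divide_right_mono)
qed

lemma nn_integral_period:
  "(\<integral>\<^sup>+ x. f x \<partial>period) = (\<integral>\<^sup>+ x. f x * indicator {0..<1} x \<partial>lborel)"
  by (simp add: period_def nn_integral_restrict_space)

text \<open>The image of the uniform measure under \<open>compress N s\<close> has density at most \<open>s\<close>. On each cell the map is
  affine with slope \<open>1/s\<close> and maps the cell into itself, so a change of variables on the cells suffices.\<close>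

lemma nn_integral_compress_le:
  fixes g :: "real \<Rightarrow> ennreal"
  assumes [measurable]: "g \<in> borel_measurable borel" and N: "N \<ge> 1" and s: "s \<ge> 1"
  shows "(\<integral>\<^sup>+ x. g (compress N s x) \<partial>period) \<le> ennreal s * (\<integral>\<^sup>+ x. g x \<partial>period)"
proof -
  define cell where "cell j = {real j / real N ..< (real j + 1) / real N}" for j
  define aff where "aff j x = (real j / real N - real j / real N / s) + (1 / s) * x" for j and x :: real
  have [measurable]: "cell j \<in> sets borel" for j by (simp add: cell_def)
  have [measurable]: "aff j \<in> borel_measurable borel" for j unfolding aff_def by measurable
  have in_cell: "x \<in> cell j \<longleftrightarrow> 0 \<le> x \<and> j = nat \<lfloor>real N * x\<rfloor>" for x j
  proof -
    have "x \<in> cell j \<longleftrightarrow> real j \<le> real N * x \<and> real N * x < real j + 1"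
      using N by (auto simp: cell_def field_simps)
    also have "\<dots> \<longleftrightarrow> \<lfloor>real N * x\<rfloor> = int j"
      by (auto simp: floor_eq_iff)
    also have "\<dots> \<longleftrightarrow> 0 \<le> x \<and> j = nat \<lfloor>real N * x\<rfloor>"
    proof
      assume *: "\<lfloor>real N * x\<rfloor> = int j"
      then have "0 \<le> real N * x" by (metis of_nat_0_le_iff zero_le_floor)
      then show "0 \<le> x \<and> j = nat \<lfloor>real N * x\<rfloor>" using * N by (simp add: zero_le_mult_iff)
    qed simp
    finally show ?thesis .
  qed
  have partition: "(\<Sum>j<N. h j * indicator (cell j) x) = h (nat \<lfloor>real N * x\<rfloor>) * indicator {0..<1} x"
    for h :: "nat \<Rightarrow> ennreal" and x
  proof (cases "0 \<le> x")
    case True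
    have lt: "nat \<lfloor>real N * x\<rfloor> < N \<longleftrightarrow> x < 1"
      using N True by (auto simp: nat_less_iff floor_less_iff)
    have "(\<Sum>j<N. h j * indicator (cell j) x) = (\<Sum>j<N. if j = nat \<lfloor>real N * x\<rfloor> then h j else 0)"
      by (intro sum.cong refl) (auto simp: indicator_def in_cell True)
    also have "\<dots> = h (nat \<lfloor>real N * x\<rfloor>) * indicator {0..<1} x"
      using lt True by (auto simp: indicator_def)
    finally show ?thesis .
  next
    case False
    then show ?thesis by (simp add: indicator_def in_cell)
  qed
  have compress_cell: "compress N s x = aff (nat \<lfloor>real N * x\<rfloor>) x" if "0 \<le> x" for x
    using that N s by (simp add: compress_def aff_def frac_def divide_simps)
  have aff_cell: "aff j x \<in> cell j" if "x \<in> cell j" for j x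
  proof -
    have "real j / real N \<le> x" "x < (real j + 1) / real N" using that by (auto simp: cell_def)
    moreover have "aff j x = real j / real N + (x - real j / real N) / s"
      by (simp add: aff_def diff_divide_distrib)
    moreover have "0 \<le> (x - real j / real N) / s" "(x - real j / real N) / s \<le> x - real j / real N"
      using divide_ge_one_le[of "x - real j / real N" s] calculation(1) s by auto
    ultimately show ?thesis by (auto simp: cell_def)
  qed
  have "(\<integral>\<^sup>+ x. g (compress N s x) \<partial>period) = (\<integral>\<^sup>+ x. (\<Sum>j<N. g (aff j x) * indicator (cell j) x) \<partial>lborel)"
    unfolding nn_integral_period
    unfolding partition by (intro nn_integral_cong) (auto simp: compress_cell split: split_indicator)
  also have "\<dots> = (\<Sum>j<N. \<integral>\<^sup>+ x. g (aff j x) * indicator (cell j) x \<partial>lborel)"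
    by (rule nn_integral_sum) measurable
  also have "\<dots> \<le> (\<Sum>j<N. ennreal s * (\<integral>\<^sup>+ x. g x * indicator (cell j) x \<partial>lborel))"
  proof (rule sum_mono)
    fix j
    have "(\<integral>\<^sup>+ x. g (aff j x) * indicator (cell j) x \<partial>lborel)
        \<le> (\<integral>\<^sup>+ x. g (aff j x) * indicator (cell j) (aff j x) \<partial>lborel)"
      by (intro nn_integral_mono) (auto simp: indicator_def aff_cell)
    also have "\<dots> = ennreal s * (\<integral>\<^sup>+ x. g x * indicator (cell j) x \<partial>lborel)"
    proof -
      have "(\<integral>\<^sup>+ x. g x * indicator (cell j) x \<partial>lborel)
          = ennreal (1 / s) * (\<integral>\<^sup>+ x. g (aff j x) * indicator (cell j) (aff j x) \<partial>lborel)"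
        unfolding aff_def using s
        by (subst nn_integral_real_affine[where c = "1 / s" and t = "real j / real N - real j / real N / s"]) auto
      moreover have "ennreal s * (ennreal (1 / s) * y) = y" for y
        using s by (simp add: mult.assoc[symmetric] ennreal_mult'[symmetric])
      ultimately show ?thesis by simp
    qed
    finally show "(\<integral>\<^sup>+ x. g (aff j x) * indicator (cell j) x \<partial>lborel)
        \<le> ennreal s * (\<integral>\<^sup>+ x. g x * indicator (cell j) x \<partial>lborel)" .
  qed
  also have "\<dots> = ennreal s * (\<integral>\<^sup>+ x. (\<Sum>j<N. g x * indicator (cell j) x) \<partial>lborel)"
    by (subst nn_integral_sum) (auto simp: sum_distrib_left)
  also have "\<dots> = ennreal s * (\<integral>\<^sup>+ x. g x \<partial>period)"
    by (simp add: nn_integral_period partition)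
  finally show ?thesis .
qed

primrec cascade :: "(nat \<Rightarrow> nat) \<Rightarrow> nat \<Rightarrow> real \<Rightarrow> real" where
  "cascade N 0 x = x"
| "cascade N (Suc n) x = compress (N n) (real (Suc n)) (cascade N n x)"

definition cascade_limit :: "(nat \<Rightarrow> nat) \<Rightarrow> real \<Rightarrow> real" where
  "cascade_limit N x = lim (\<lambda>n. cascade N n x)"

lemma measurable_cascade [measurable]: "cascade N n \<in> borel_measurable borel"
proof (induction n)
  case (Suc n)
  note [measurable] = Suc
  have "(\<lambda>x. compress (N n) (real (Suc n)) (cascade N n x)) \<in> borel_measurable borel" by measurable
  then show ?case by simp
qed simp

text \<open>The density bounds \<open>1, 2, \<dots>, n\<close> of the successive steps multiply. The one-step bound
  holds for every test function, in particular for those composed with a later step.\<close>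

lemma nn_integral_cascade_le:
  assumes N: "\<And>n. N n \<ge> 1" and [measurable]: "g \<in> borel_measurable borel"
  shows "(\<integral>\<^sup>+ x. g (cascade N n x) \<partial>period) \<le> ennreal (fact n) * (\<integral>\<^sup>+ x. g x \<partial>period)"
  using assms(2)
proof (induction n arbitrary: g)
  case (Suc n)
  note [measurable] = Suc.prems
  have "(\<integral>\<^sup>+ x. g (cascade N (Suc n) x) \<partial>period)
      \<le> ennreal (fact n) * (\<integral>\<^sup>+ x. g (compress (N n) (real (Suc n)) x) \<partial>period)"
    using Suc.IH[of "\<lambda>x. g (compress (N n) (real (Suc n)) x)"] by simp
  also have "\<dots> \<le> ennreal (fact n) * (ennreal (real (Suc n)) * (\<integral>\<^sup>+ x. g x \<partial>period))"
    by (intro mult_left_mono nn_integral_compress_le N) auto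
  also have "\<dots> = ennreal (fact (Suc n)) * (\<integral>\<^sup>+ x. g x \<partial>period)"
    by (simp add: mult.assoc[symmetric] ennreal_mult'[symmetric] mult.commute del: of_nat_Suc)
  finally show ?case .
qed simp

context
  fixes N :: "nat \<Rightarrow> nat"
  assumes N0: "N 0 \<ge> 1" and growth: "\<And>n. N (Suc n) \<ge> 2 * Suc n * N n"
begin

lemma lacunary_ge: "N n \<ge> Suc n"
proof (induction n)
  case (Suc n)
  have "Suc (Suc n) \<le> 2 * Suc n * 1" by simp
  also have "\<dots> \<le> 2 * Suc n * N n" using Suc by (intro mult_left_mono) auto
  also have "\<dots> \<le> N (Suc n)" by (rule growth)
  finally show ?case .
qed (use N0 in simp)

lemma lacunary_pos: "N n \<ge> 1"
  using lacunary_ge[of n] by simp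

lemma lacunary_strict_mono: "strict_mono N"
proof (rule strict_monoI_Suc)
  fix n
  have "N n < 2 * Suc n * N n" using lacunary_pos[of n] by simp
  then show "N n < N (Suc n)" using growth[of n] by linarith
qed

lemma inverse_lacunary_step: "real (Suc n) * (2 / real (N (Suc n))) \<le> 1 / real (N n)"
proof -
  have "real (2 * Suc n * N n) \<le> real (N (Suc n))" using growth[of n] by (simp only: of_nat_le_iff)
  then show ?thesis
    using lacunary_pos[of n] lacunary_pos[of "Suc n"] by (simp add: field_simps)
qed

text \<open>Step \<open>m\<close> moves points by at most \<open>1/N\<^sub>m\<close>, and \<open>N\<^bsub>m+1\<^esub> \<ge> 2 N\<^sub>m\<close> makes this at most
  \<open>2/N\<^sub>m - 2/N\<^bsub>m+1\<^esub>\<close>, which telescopes.\<close>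

lemma cascade_increment_le:
  "\<bar>cascade N (n + k) x - cascade N n x\<bar> \<le> 2 / real (N n) - 2 / real (N (n + k))"
proof (induction k)
  case (Suc k)
  have "\<bar>cascade N (Suc (n + k)) x - cascade N (n + k) x\<bar> \<le> 1 / real (N (n + k))"
    using compress_dist_le[OF lacunary_pos, of "real (Suc (n + k))"] by simp
  moreover have "2 / real (N (Suc (n + k))) \<le> 1 / real (N (n + k))"
  proof -
    have "1 * (2 / real (N (Suc (n + k)))) \<le> real (Suc (n + k)) * (2 / real (N (Suc (n + k))))"
      by (intro mult_right_mono) auto
    then show ?thesis using inverse_lacunary_step[of "n + k"] by linarith
  qed
  ultimately show ?case using Suc by (simp add: field_simps)
qed simp

lemma inverse_lacunary_tendsto: "(\<lambda>n. 2 / real (N n)) \<longlonglongrightarrow> 0"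
proof (rule tendsto_sandwich[OF _ _ tendsto_const])
  show "(\<lambda>n. 2 / real (Suc n)) \<longlonglongrightarrow> 0"
    using tendsto_mult_right_zero[OF LIMSEQ_inverse_real_of_nat, of 2] by (simp add: divide_inverse)
  show "eventually (\<lambda>n. 2 / real (N n) \<le> 2 / real (Suc n)) sequentially"
    by (intro always_eventually allI frac_le) (use lacunary_ge in \<open>auto simp del: of_nat_Suc\<close>)
qed auto

lemma cascade_tendsto: "(\<lambda>n. cascade N n x) \<longlonglongrightarrow> cascade_limit N x"
proof -
  have "Cauchy (\<lambda>n. cascade N n x)"
  proof (rule metric_CauchyI)
    fix e :: real assume "e > 0"
    then obtain M where M: "\<And>n. n \<ge> M \<Longrightarrow> 2 / real (N n) < e"
      using order_tendstoD(2)[OF inverse_lacunary_tendsto, of e] by (auto simp: eventually_sequentially)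
    have near: "dist (cascade N m x) (cascade N n x) < e" if "n \<ge> M" "n \<le> m" for m n
    proof -
      have "0 \<le> 2 / real (N m)" by simp
      then show ?thesis
        using cascade_increment_le[of n "m - n" x] M[OF that(1)] that
        unfolding dist_real_def by (simp only: le_add_diff_inverse)
    qed
    show "\<exists>M. \<forall>m\<ge>M. \<forall>n\<ge>M. dist (cascade N m x) (cascade N n x) < e"
      by (metis near dist_commute nle_le)
  qed
  then show ?thesis
    unfolding cascade_limit_def by (simp add: Cauchy_convergent_iff convergent_LIMSEQ_iff)
qed

lemma cascade_limit_dist_le: "\<bar>cascade_limit N x - cascade N n x\<bar> \<le> 2 / real (N n)"
proof (rule LIMSEQ_le_const2)
  show "(\<lambda>k. \<bar>cascade N (n + k) x - cascade N n x\<bar>) \<longlonglongrightarrow> \<bar>cascade_limit N x - cascade N n x\<bar>"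
    using LIMSEQ_ignore_initial_segment[OF cascade_tendsto, of n]
    by (intro tendsto_intros) (simp add: add.commute)
  have "\<bar>cascade N (n + k) x - cascade N n x\<bar> \<le> 2 / real (N n)" for k
  proof -
    have "0 \<le> 2 / real (N (n + k))" by simp
    then show ?thesis using cascade_increment_le[of n k x] by linarith
  qed
  then show "\<exists>K. \<forall>k\<ge>K. \<bar>cascade N (n + k) x - cascade N n x\<bar> \<le> 2 / real (N n)" by blast
qed

lemma measurable_cascade_limit [measurable]: "cascade_limit N \<in> borel_measurable borel"
  by (rule borel_measurable_LIMSEQ_real[OF cascade_tendsto]) auto

text \<open>Right after step \<open>n\<close> every point is within \<open>1/((n+1) N\<^sub>n)\<close> of the grid of the \<open>N\<^sub>n\<close>-th roots of
  unity, and the factor \<open>2 (n+1)\<close> in the growth condition keeps all later displacements at most as large.\<close>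

lemma unit_circ_cascade_limit_power_tendsto:
  "(\<lambda>n. unit_circ (cascade_limit N x) ^ N n) \<longlonglongrightarrow> 1"
proof (rule LIM_zero_cancel, rule Lim_null_comparison)
  have "cmod (unit_circ (cascade_limit N x) ^ N n - 1) \<le> 4 * pi * inverse (real (Suc n))" for n
  proof -
    let ?y = "real (N n) * cascade_limit N x"
    obtain m :: int where m: "\<bar>real (N n) * cascade N (Suc n) x - of_int m\<bar> \<le> 1 / real (Suc n)"
      using compress_near_grid[OF lacunary_pos, of "real (Suc n)"] by auto
    have "real (N n) * \<bar>cascade_limit N x - cascade N (Suc n) x\<bar> \<le> real (N n) * (2 / real (N (Suc n)))"
      by (intro mult_left_mono cascade_limit_dist_le) simp
    also have "\<dots> \<le> 1 / real (Suc n)"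
      using inverse_lacunary_step[of n] lacunary_pos[of n] by (simp add: field_simps del: of_nat_Suc)
    finally have "\<bar>?y - real (N n) * cascade N (Suc n) x\<bar> \<le> 1 / real (Suc n)"
      unfolding right_diff_distrib[symmetric] abs_mult by simp
    with m have "\<bar>?y - of_int m\<bar> \<le> 2 / real (Suc n)" by linarith
    moreover have "cmod (unit_circ ?y - unit_circ (of_int m)) \<le> 2 * pi * \<bar>?y - of_int m\<bar>"
      by (rule dist_unit_circ_le)
    moreover have "unit_circ (of_int m) = 1"
      using unit_circ_add_int[of 0 m] by (simp add: unit_circ_def)
    ultimately have "cmod (unit_circ ?y - 1) \<le> 2 * pi * (2 / real (Suc n))"
      by (smt (verit) mult_left_mono pi_gt_zero)
    then show ?thesis by (simp add: unit_circ_power divide_inverse del: of_nat_Suc)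
  qed
  then show "eventually (\<lambda>n. cmod (unit_circ (cascade_limit N x) ^ N n - 1)
      \<le> 4 * pi * inverse (real (Suc n))) sequentially" by simp
  show "(\<lambda>n. 4 * pi * inverse (real (Suc n))) \<longlonglongrightarrow> 0"
    by (rule tendsto_mult_right_zero[OF LIMSEQ_inverse_real_of_nat])
qed

end

section \<open>Singularity with respect to Lebesgue measure\<close>

text \<open>On the set \<open>B\<close> where the powers converge to \<open>1\<close>, so do their averages over the blocks
  \<open>m \<le> n < 2m\<close> (indexed by \<open>m - 1\<close> in the proof). By Parseval these averages have mean square
  \<open>1/m\<close>, so dominated convergence forces \<open>B\<close> to be null.\<close>

lemma period_lacunary_convergence_null:
  assumes N: "strict_mono N"
  shows "emeasure period {x \<in> {0..<1}. (\<lambda>n. unit_circ x ^ N n) \<longlonglongrightarrow> 1} = 0"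
proof -
  interpret finite_measure period by (rule finite_measure_period)
  define B where "B = {x. (\<lambda>n. unit_circ x ^ N n) \<longlonglongrightarrow> 1}"
  have [measurable]: "B \<in> sets borel"
    unfolding B_def by measurable
  have B': "{x \<in> {0..<1}. (\<lambda>n. unit_circ x ^ N n) \<longlonglongrightarrow> 1} = B \<inter> space period"
    by (auto simp: B_def)
  have B_period: "B \<inter> space period \<in> sets period"
    by (auto simp: period_def sets_restrict_space)
  define S where "S m x = (\<Sum>n\<in>{Suc m..<2 * Suc m}. of_real (1 / real (Suc m)) * unit_circ x ^ N n)" for m x
  have S_meas [measurable]: "S m \<in> borel_measurable borel" for m unfolding S_def by measurable
  have S_bound: "cmod (S m x) \<le> 1" for m x
  proof -
    have "cmod (S m x) \<le> (\<Sum>n\<in>{Suc m..<2 * Suc m}. 1 / real (Suc m))"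
      unfolding S_def
      by (rule order_trans[OF norm_sum]) (simp add: norm_mult norm_power del: of_real_divide of_nat_Suc)
    also have "\<dots> = 1" by simp
    finally show ?thesis .
  qed
  have S_sq: "(cmod (S m x))\<^sup>2 \<le> 1" for m x
    using S_bound[of m x] by (simp add: power_le_one)
  have S_lim: "(\<lambda>m. S m x) \<longlonglongrightarrow> 1" if x: "x \<in> B" for x
  proof (rule metric_LIMSEQ_I)
    fix e :: real assume "e > 0"
    then obtain K where K: "\<And>n. n \<ge> K \<Longrightarrow> cmod (unit_circ x ^ N n - 1) < e / 2"
      using LIMSEQ_D[of "\<lambda>n. unit_circ x ^ N n" 1 "e / 2"] x unfolding B_def mem_Collect_eq
      by (meson half_gt_zero)
    have "cmod (S m x - 1) < e" if "m \<ge> K" for m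
    proof -
      have "S m x - 1 = (\<Sum>n\<in>{Suc m..<2 * Suc m}. of_real (1 / real (Suc m)) * (unit_circ x ^ N n - 1))"
      proof -
        have "(\<Sum>n\<in>{Suc m..<2 * Suc m}. complex_of_real (1 / real (Suc m)))
            = of_real (\<Sum>n\<in>{Suc m..<2 * Suc m}. 1 / real (Suc m))"
          by (simp only: of_real_sum)
        also have "(\<Sum>n\<in>{Suc m..<2 * Suc m}. 1 / real (Suc m)) = 1" by simp
        finally show ?thesis
          unfolding S_def right_diff_distrib sum_subtractf by simp
      qed
      also have "cmod \<dots> \<le> (\<Sum>n\<in>{Suc m..<2 * Suc m}. 1 / real (Suc m) * (e / 2))"
      proof (intro order_trans[OF norm_sum] sum_mono)
        fix n assume "n \<in> {Suc m..<2 * Suc m}"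
        then have "cmod (unit_circ x ^ N n - 1) \<le> e / 2" using K[of n] that by simp
        then show "cmod (of_real (1 / real (Suc m)) * (unit_circ x ^ N n - 1)) \<le> 1 / real (Suc m) * (e / 2)"
          unfolding norm_mult norm_of_real by (intro mult_mono) auto
      qed
      also have "\<dots> = e / 2" by (simp add: field_simps)
      finally show ?thesis using \<open>e > 0\<close> by linarith
    qed
    then show "\<exists>no. \<forall>n\<ge>no. dist (S n x) 1 < e" by (auto simp: dist_norm)
  qed
  have conv: "(\<lambda>m. LINT x|period. indicator B x * (cmod (S m x))\<^sup>2) \<longlonglongrightarrow> (LINT x|period. indicator B x)"
  proof (rule integral_dominated_convergence[where w = "\<lambda>_. 1"])
    show "AE x in period. (\<lambda>m. indicator B x * (cmod (S m x))\<^sup>2) \<longlonglongrightarrow> indicator B x"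
    proof (rule AE_I2)
      fix x
      show "(\<lambda>m. indicator B x * (cmod (S m x))\<^sup>2) \<longlonglongrightarrow> indicator B x"
      proof (cases "x \<in> B")
        case True
        have "(\<lambda>m. indicator B x * (cmod (S m x))\<^sup>2) \<longlonglongrightarrow> indicator B x * (cmod 1)\<^sup>2"
          by (intro tendsto_intros S_lim True)
        then show ?thesis by simp
      qed simp
    qed
    show "\<And>m. AE x in period. norm (indicator B x * (cmod (S m x))\<^sup>2) \<le> 1"
      using S_sq by (auto simp: indicator_def)
  qed (auto intro!: measurable_period)
  have upper: "(LINT x|period. indicator B x * (cmod (S m x))\<^sup>2) \<le> inverse (real (Suc m))" for m
  proof -
    have "(LINT x|period. indicator B x * (cmod (S m x))\<^sup>2) \<le> (LINT x|period. (cmod (S m x))\<^sup>2)"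
    proof (rule integral_mono)
      show "integrable period (\<lambda>x. indicator B x * (cmod (S m x))\<^sup>2)"
        by (rule integrable_period_bounded[where B = 1]) (use S_sq in \<open>auto simp: indicator_def\<close>)
      show "integrable period (\<lambda>x. (cmod (S m x))\<^sup>2)"
        by (rule integrable_period_bounded[where B = 1]) (use S_sq in auto)
    qed (auto simp: indicator_def)
    also have "\<dots> = (\<Sum>n\<in>{Suc m..<2 * Suc m}. (cmod (of_real (1 / real (Suc m))))\<^sup>2)"
      unfolding S_def
      by (rule trig_polynomial_Parseval) (use strict_mono_imp_inj_on[OF N] in \<open>auto intro: inj_on_subset\<close>)
    also have "\<dots> = inverse (real (Suc m))"
      by (simp add: norm_divide power2_eq_square divide_simps del: of_nat_Suc)
    finally show ?thesis .
  qed
  have "(LINT x|period. indicator B x) \<le> (0::real)"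
    by (rule LIMSEQ_le[OF conv LIMSEQ_inverse_real_of_nat]) (use upper in auto)
  also have "(LINT x|period. indicator B x) = measure period (B \<inter> space period)"
    by simp
  finally have "measure period (B \<inter> space period) = 0"
    using measure_nonneg[of period "B \<inter> space period"] by linarith
  then show ?thesis
    unfolding B' emeasure_eq_measure by simp
qed

lemma lacunary_convergence_set_measurable [measurable]:
  "{\<zeta> \<in> sphere 0 1. (\<lambda>n. \<zeta> ^ N n) \<longlonglongrightarrow> 1} \<in> sets circle_borel"
proof -
  have "{\<zeta> :: complex. (\<lambda>n. \<zeta> ^ N n) \<longlonglongrightarrow> 1} \<in> sets borel" by measurable
  then show ?thesis
    unfolding circle_borel_def sets_restrict_space by (auto intro!: image_eqI[where x = "{\<zeta>. (\<lambda>n. \<zeta> ^ N n) \<longlonglongrightarrow> 1}"])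
qed

lemma emeasure_circle_lebesgue:
  assumes A: "A \<in> sets circle_borel"
  shows "emeasure circle_lebesgue A = ennreal (2 * pi) * emeasure period {x \<in> {0..<1}. unit_circ x \<in> A}"
proof -
  have A_borel [measurable]: "A \<in> sets borel"
  proof -
    have "sphere 0 1 \<in> sets (borel :: complex measure)" by (intro borel_closed closed_sphere)
    then show ?thesis using A unfolding circle_borel_def sets_restrict_space by auto
  qed
  have cis_meas [measurable]: "cis \<in> borel_measurable borel"
    by (intro borel_measurable_continuous_onI continuous_intros)
  have "emeasure circle_lebesgue A = emeasure lborel {t \<in> {0..<2 * pi}. cis t \<in> A}"
    unfolding circle_lebesgue_def
  proof (subst emeasure_distr[OF cis_measurable_circle A])
    let ?R = "restrict_space lborel {0..<2 * pi}"
    have "cis -` A \<inter> space ?R = {t \<in> {0..<2 * pi}. cis t \<in> A}"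
      by (auto simp: space_restrict_space)
    then show "emeasure ?R (cis -` A \<inter> space ?R) = emeasure lborel {t \<in> {0..<2 * pi}. cis t \<in> A}"
      by (subst emeasure_restrict_space) auto
  qed
  also have "\<dots> = (\<integral>\<^sup>+ t. indicator {t \<in> {0..<2 * pi}. cis t \<in> A} t \<partial>lborel)"
    by simp
  also have "\<dots> = ennreal (2 * pi) * (\<integral>\<^sup>+ x. indicator {t \<in> {0..<2 * pi}. cis t \<in> A} (0 + 2 * pi * x) \<partial>lborel)"
    by (subst nn_integral_real_affine[where c = "2 * pi" and t = 0]) auto
  also have "(\<integral>\<^sup>+ x. indicator {t \<in> {0..<2 * pi}. cis t \<in> A} (0 + 2 * pi * x) \<partial>lborel)
      = (\<integral>\<^sup>+ x. indicator {x \<in> {0..<1}. unit_circ x \<in> A} x \<partial>lborel)"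
  proof (intro nn_integral_cong)
    fix x
    have "0 \<le> 2 * pi * x \<longleftrightarrow> 0 \<le> x" "2 * pi * x < 2 * pi \<longleftrightarrow> x < 1"
      by (simp_all add: zero_le_mult_iff pi_gt_zero[THEN less_imp_le] not_le[THEN iffD2, OF pi_gt_zero])
    then show "indicator {t \<in> {0..<2 * pi}. cis t \<in> A} (0 + 2 * pi * x)
        = (indicator {x \<in> {0..<1}. unit_circ x \<in> A} x :: ennreal)"
      by (simp add: indicator_def unit_circ_def)
  qed
  also have "\<dots> = emeasure period {x \<in> {0..<1}. unit_circ x \<in> A}"
    unfolding period_def by (subst emeasure_restrict_space) (auto simp: nn_integral_indicator)
  finally show ?thesis .
qed

section \<open>Moduli of continuity\<close>

text \<open>Positivity matters because division by \<open>0\<close> gives \<open>0\<close>: where \<open>\<omega>\<close> vanished, the bound in the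
  definition of \<open>Lambda_a\<close> would carry no information.\<close>

lemma modulus_of_continuity_pos:
  assumes "modulus_of_continuity \<omega>" "t > 0"
  shows "\<omega> t > 0"
proof -
  have "eventually (\<lambda>s. \<omega> s / s > 0) (at_right 0)"
    using assms(1) by (auto simp: modulus_of_continuity_def filterlim_at_top_dense)
  moreover have "eventually (\<lambda>s. s \<in> {0<..<t}) (at_right 0)"
    by (rule eventually_at_right_real[OF assms(2)])
  ultimately have "eventually (\<lambda>s. \<omega> s / s > 0 \<and> s \<in> {0<..<t}) (at_right 0)"
    by (rule eventually_conj)
  then obtain s where "\<omega> s / s > 0" "0 < s" "s < t"
    using eventually_happens'[OF trivial_limit_at_right_real] by fastforce
  moreover from this have "\<omega> s \<le> \<omega> t"
    using assms(1) by (auto simp: modulus_of_continuity_def mono_on_def)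
  ultimately show ?thesis by (simp add: zero_less_divide_iff)
qed

lemma modulus_of_continuity_small:
  assumes "modulus_of_continuity \<omega>" "\<epsilon> > 0"
  shows "\<exists>t. 0 < t \<and> t \<le> 1/2 \<and> \<omega> t \<le> \<epsilon>"
proof -
  have "\<forall>x\<in>{0..}. \<forall>e>0. \<exists>d>0. \<forall>x'\<in>{0..}. dist x' x < d \<longrightarrow> dist (\<omega> x') (\<omega> x) < e"
    using assms(1) unfolding modulus_of_continuity_def continuous_on_iff by blast
  then have "\<exists>d>0. \<forall>x'\<in>{0..}. dist x' 0 < d \<longrightarrow> dist (\<omega> x') (\<omega> 0) < \<epsilon>"
    using assms(2) atLeast_iff[of 0 "0::real"] by blast
  moreover have "\<omega> 0 = 0" using assms(1) by (simp add: modulus_of_continuity_def)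
  ultimately obtain d where d: "d > 0" "\<And>x. x \<ge> 0 \<Longrightarrow> dist x 0 < d \<Longrightarrow> dist (\<omega> x) 0 < \<epsilon>"
    by auto
  have "0 < min (d / 2) (1/2) \<and> min (d / 2) (1/2) \<le> 1/2 \<and> \<omega> (min (d / 2) (1/2)) \<le> \<epsilon>"
    using d(1) d(2)[of "min (d / 2) (1/2)"] by (auto simp: dist_real_def min_def split: if_splits)
  then show ?thesis by blast
qed

lemma Lambda_a_modulus:
  assumes \<omega>: "modulus_of_continuity \<omega>" and f: "f \<in> Lambda_a \<omega>"
  obtains C where "0 \<le> C" "\<And>z w. cmod z < 1 \<Longrightarrow> cmod w < 1 \<Longrightarrow> cmod (f z - f w) \<le> C * \<omega> (cmod (z - w))"
proof -
  obtain F where F: "\<forall>z\<in>ball 0 1. F z = f z"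
    and bdd: "bdd_above {cmod (F z - F w) / \<omega> (cmod (z - w)) | z w.
                  z \<in> cball 0 1 \<and> w \<in> cball 0 1 \<and> z \<noteq> w}"
    using f unfolding Lambda_a_def mem_Collect_eq by (elim conjE exE)
  from bdd obtain M where "\<forall>x\<in>{cmod (F z - F w) / \<omega> (cmod (z - w)) | z w.
                  z \<in> cball 0 1 \<and> w \<in> cball 0 1 \<and> z \<noteq> w}. x \<le> M"
    unfolding bdd_above_def by (elim exE)
  then have M: "cmod (F z - F w) / \<omega> (cmod (z - w)) \<le> M"
    if "z \<in> cball 0 1" "w \<in> cball 0 1" "z \<noteq> w" for z w
    by (rule bspec, intro CollectI exI[of _ z] exI[of _ w] conjI refl that)
  have "cmod (f z - f w) \<le> max M 0 * \<omega> (cmod (z - w))" if "cmod z < 1" "cmod w < 1" for z w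
  proof (cases "z = w")
    case True
    then show ?thesis using \<omega> by (simp add: modulus_of_continuity_def)
  next
    case False
    have pos: "\<omega> (cmod (z - w)) > 0"
      using False by (intro modulus_of_continuity_pos[OF \<omega>]) simp
    have "cmod (f z - f w) / \<omega> (cmod (z - w)) \<le> max M 0"
      using M[of z w] F that False by (simp add: max_def)
    then show ?thesis using pos by (simp add: divide_le_eq)
  qed
  then show ?thesis using that[of "max M 0"] by simp
qed

section \<open>The inner function of a cascade\<close>

text \<open>The growth condition prescribes lower bounds only, so any further lower bounds \<open>R\<close> can be met
  simultaneously.\<close>

lemma ex_lacunary_above:
  fixes R :: "nat \<Rightarrow> real"
  obtains N :: "nat \<Rightarrow> nat" where "N 0 \<ge> 1" "\<And>n. N (Suc n) \<ge> 2 * Suc n * N n" "\<And>n. real (N n) \<ge> R n"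
proof -
  define N where "N = rec_nat (1 + nat \<lceil>R 0\<rceil>) (\<lambda>n v. 2 * Suc n * v + nat \<lceil>R (Suc n)\<rceil>)"
  have "real (N n) \<ge> R n" for n
  proof (cases n)
    case 0
    then show ?thesis using of_nat_ceiling[of "R 0"] by (simp add: N_def)
  next
    case (Suc m)
    have "R (Suc m) \<le> real (nat \<lceil>R (Suc m)\<rceil>)" by (rule of_nat_ceiling)
    also have "\<dots> \<le> real (N (Suc m))" by (simp add: N_def)
    finally show ?thesis by (simp add: Suc)
  qed
  then show ?thesis by (intro that[of N]) (auto simp: N_def)
qed

lemma measurable_cascade_point:
  assumes N0: "N 0 \<ge> 1" and growth: "\<And>n. N (Suc n) \<ge> 2 * Suc n * N n"
  shows "(\<lambda>x. unit_circ (cascade_limit N x)) \<in> measurable period circle_borel"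
  unfolding circle_borel_def
  by (intro measurable_restrict_space2 measurable_period
      measurable_compose[OF measurable_cascade_limit[OF N0 growth] measurable_unit_circ]) auto

definition cascade_measure :: "(nat \<Rightarrow> nat) \<Rightarrow> complex measure" where
  "cascade_measure N = distr period circle_borel (\<lambda>x. unit_circ (cascade_limit N x))"

context
  fixes N :: "nat \<Rightarrow> nat"
  assumes N0: "N 0 \<ge> 1" and growth: "\<And>n. N (Suc n) \<ge> 2 * Suc n * N n"
begin

lemma cascade_point_borel: "(\<lambda>x. unit_circ (cascade_limit N x)) \<in> borel_measurable borel"
  by (rule measurable_compose[OF measurable_cascade_limit[OF N0 growth] measurable_unit_circ])

lemma cascade_stage_borel: "(\<lambda>x. unit_circ (cascade N n x)) \<in> borel_measurable borel"
  by measurable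

lemma singular_inner_cascade_measure: "singular_inner (singular_inner_fun (cascade_measure N))"
proof -
  let ?\<nu> = "cascade_measure N" and ?u = "\<lambda>x. unit_circ (cascade_limit N x)"
  let ?A = "{\<zeta> \<in> sphere 0 1. (\<lambda>n. \<zeta> ^ N n) \<longlonglongrightarrow> 1}"
  note u = measurable_cascade_point[OF N0 growth]
  have sets: "sets ?\<nu> = sets circle_borel" and space: "space ?\<nu> = sphere 0 1"
    by (simp_all add: cascade_measure_def circle_borel_def space_restrict_space)
  have total: "emeasure ?\<nu> (space ?\<nu>) = 1"
  proof -
    have "?u -` space ?\<nu> \<inter> space period = {0..<1}" by (auto simp: space)
    then show ?thesis
      unfolding cascade_measure_def by (subst emeasure_distr[OF u]) (auto simp: space)
  qed
  have A: "?A \<in> sets circle_borel" by (rule lacunary_convergence_set_measurable)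
  have "emeasure ?\<nu> (space ?\<nu> - ?A) = 0"
  proof -
    have "?u -` (space ?\<nu> - ?A) \<inter> space period = {}"
      using unit_circ_cascade_limit_power_tendsto[OF N0 growth] by auto
    moreover have "space ?\<nu> - ?A \<in> sets circle_borel"
      using sets.compl_sets[of ?A ?\<nu>] A unfolding sets by simp
    ultimately show ?thesis
      unfolding cascade_measure_def by (subst emeasure_distr[OF u]) auto
  qed
  moreover have "emeasure circle_lebesgue ?A = 0"
    using period_lacunary_convergence_null[OF lacunary_strict_mono[OF N0 growth]]
    unfolding emeasure_circle_lebesgue[OF A] by simp
  moreover have "sets circle_lebesgue = sets circle_borel"
    by (simp add: circle_lebesgue_def)
  ultimately have "mutually_singular ?\<nu> circle_lebesgue"
    unfolding mutually_singular_def using A sets by (intro bexI[of _ ?A] conjI IntI) simp_all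
  then show ?thesis
    unfolding singular_inner_def using sets total
    by (intro exI[of _ ?\<nu>]) (auto intro: finite_measureI)
qed

lemma singular_inner_fun_cascade_measure:
  assumes "cmod z < 1"
  shows "singular_inner_fun (cascade_measure N) z = exp (- herglotz (\<lambda>x. unit_circ (cascade_limit N x)) z)"
proof -
  have "(\<lambda>\<zeta>. (\<zeta> + z) / (\<zeta> - z)) \<in> borel_measurable circle_borel"
    unfolding circle_borel_def by (intro measurable_restrict_space1) measurable
  then have "(LINT \<zeta>|cascade_measure N. (\<zeta> + z) / (\<zeta> - z))
      = herglotz (\<lambda>x. unit_circ (cascade_limit N x)) z"
    unfolding cascade_measure_def herglotz_def
    by (rule integral_distr[OF measurable_cascade_point[OF N0 growth]])
  then show ?thesis using assms by (simp add: singular_inner_fun_def)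
qed

lemma Re_herglotz_cascade_le:
  assumes "cmod z < 1"
  shows "Re (herglotz (\<lambda>x. unit_circ (cascade N n x)) z) \<le> fact n"
  using nn_integral_cascade_le[of N, OF lacunary_pos[OF N0 growth]] assms
  by (intro Re_herglotz_le_density) auto

lemma herglotz_cascade_dist_le:
  assumes t: "0 < t" "t \<le> 1 - cmod z" and large: "real (N n) \<ge> 64 * real (Suc n) / t\<^sup>2"
  shows "cmod (herglotz (\<lambda>x. unit_circ (cascade N n x)) z - herglotz (\<lambda>x. unit_circ (cascade_limit N x)) z)
    \<le> 1 / (2 * real (Suc n))"
proof -
  have z: "cmod z < 1" using t by simp
  have Npos: "real (N n) > 0" using lacunary_pos[OF N0 growth, of n] by simp
  have "cmod (herglotz (\<lambda>x. unit_circ (cascade N n x)) z - herglotz (\<lambda>x. unit_circ (cascade_limit N x)) z)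
      \<le> 2 * (2 * pi * (2 / real (N n))) / (1 - cmod z)\<^sup>2"
  proof (rule herglotz_dist_le[OF cascade_stage_borel _ cascade_point_borel])
    fix x
    have "cmod (unit_circ (cascade N n x) - unit_circ (cascade_limit N x))
        \<le> 2 * pi * \<bar>cascade N n x - cascade_limit N x\<bar>"
      by (rule dist_unit_circ_le)
    also have "\<dots> \<le> 2 * pi * (2 / real (N n))"
      using cascade_limit_dist_le[OF N0 growth, of x n] by (intro mult_left_mono) (auto simp: abs_minus_commute)
    finally show "cmod (unit_circ (cascade N n x) - unit_circ (cascade_limit N x)) \<le> 2 * pi * (2 / real (N n))" .
  qed (use z in auto)
  also have "\<dots> \<le> 2 * (2 * 4 * (2 / real (N n))) / t\<^sup>2"
    using t Npos pi_less_4 by (intro frac_le mult_left_mono mult_right_mono power_mono) auto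
  also have "\<dots> = 32 / (real (N n) * t\<^sup>2)" by simp
  also have "\<dots> \<le> 32 / (64 * real (Suc n))"
    using large t Npos by (intro divide_left_mono) (auto simp: divide_le_eq intro!: mult_pos_pos)
  also have "\<dots> = 1 / (2 * real (Suc n))" by (simp add: divide_simps del: of_nat_Suc)
  finally show ?thesis .
qed

text \<open>The exponential of the Herglotz integral of stage \<open>n\<close> nearly inverts the inner function on the disk
  of radius \<open>1 - t\<close>: the two exponents differ by at most \<open>1/(2 (n+1))\<close> there.\<close>

lemma exp_herglotz_cascade_near_1:
  assumes t: "0 < t" "t \<le> 1 - cmod z" and large: "real (N n) \<ge> 64 * real (Suc n) / t\<^sup>2"
  shows "cmod (singular_inner_fun (cascade_measure N) z * exp (herglotz (\<lambda>x. unit_circ (cascade N n x)) z) - 1)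
    \<le> 1 / real (Suc n)"
proof -
  let ?D = "herglotz (\<lambda>x. unit_circ (cascade N n x)) z - herglotz (\<lambda>x. unit_circ (cascade_limit N x)) z"
  have D: "cmod ?D \<le> 1 / (2 * real (Suc n))" by (rule herglotz_cascade_dist_le[OF assms])
  also have "\<dots> \<le> 1 / 2" by (simp add: divide_simps)
  finally have "cmod (exp ?D - 1) \<le> 3 / 2 * cmod ?D" by (rule norm_exp_bounds)
  also have "\<dots> \<le> 3 / 2 * (1 / (2 * real (Suc n)))"
    by (rule mult_left_mono[OF D]) simp
  also have "\<dots> \<le> 1 / real (Suc n)" by (simp add: divide_simps)
  finally show ?thesis
    using t by (simp add: singular_inner_fun_cascade_measure flip: exp_add)
qed

text \<open>The test function is \<open>z^k\<close> times the inner function times the exponential of the Herglotz integral of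
  stage \<open>n\<close>. Its size is governed by the density \<open>n!\<close> of that stage, which is what the smoothness of \<open>f\<close>
  at scale \<open>t\<close>, measured by \<open>E\<close>, has to beat.\<close>

lemma model_space_coefficient_estimate:
  assumes f: "f \<in> model_space (singular_inner_fun (cascade_measure N))"
    and t: "0 < t" "t \<le> 1 / 2" and large: "real (N n) \<ge> 64 * real (Suc n) / t\<^sup>2"
    and dilate: "\<And>z. cmod z < 1 \<Longrightarrow> cmod (f z - f (of_real (1 - t) * z)) \<le> E"
    and F: "\<And>m. (\<Sum>j<m. (cmod (taylor_coeff f j))\<^sup>2) \<le> F\<^sup>2" "0 \<le> F"
  shows "(1 / 2) ^ k * cmod (taylor_coeff f k) \<le> F * (1 / real (Suc n)) + E * exp (fact n)"
proof -
  let ?\<theta> = "singular_inner_fun (cascade_measure N)"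
  let ?u = "\<lambda>x. unit_circ (cascade_limit N x)" and ?v = "\<lambda>x. unit_circ (cascade N n x)"
  define h where "h z = (if z \<in> ball 0 1 then z ^ k * exp (herglotz ?v z) else 0)" for z
  have hol_v: "herglotz ?v holomorphic_on ball 0 1"
    by (rule herglotz_holomorphic[OF cascade_stage_borel]) simp
  have hol_u: "herglotz ?u holomorphic_on ball 0 1"
    by (rule herglotz_holomorphic[OF cascade_point_borel]) simp
  have power_le: "cmod (z ^ k) \<le> 1" if "cmod z < 1" for z
    using that by (simp add: norm_power power_le_one)
  have h_an: "h \<in> disk_analytic"
  proof -
    have "(\<lambda>z. z ^ k * exp (herglotz ?v z)) holomorphic_on ball 0 1"
      by (intro holomorphic_intros holomorphic_on_compose[OF hol_v, unfolded o_def] hol_v)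
    then have "h holomorphic_on ball 0 1"
      by (rule holomorphic_transform) (simp add: h_def)
    then show ?thesis by (simp add: disk_analytic_def h_def)
  qed
  have h_bound: "cmod (h z) \<le> exp (fact n)" if z: "cmod z < 1" for z
  proof -
    have "cmod (h z) = cmod (z ^ k) * exp (Re (herglotz ?v z))"
      using z by (simp add: h_def norm_mult)
    also have "\<dots> \<le> 1 * exp (fact n)"
      by (intro mult_mono power_le z) (use Re_herglotz_cascade_le[OF z] in auto)
    finally show ?thesis by simp
  qed
  have h_H2: "h \<in> H2" by (rule bounded_disk_analytic_in_H2[OF h_an h_bound])
  define G where "G z = ?\<theta> z * h z" for z
  have theta_le: "cmod (?\<theta> z) \<le> 1" if z: "cmod z < 1" for z
    using Re_herglotz_nonneg[OF cascade_point_borel _ z] z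
    by (simp add: singular_inner_fun_cascade_measure)
  have G_bound: "cmod (G z) \<le> exp (fact n)" if z: "cmod z < 1" for z
    using mult_mono[OF theta_le[OF z] h_bound[OF z]] by (simp add: G_def norm_mult)
  have G_an: "G \<in> disk_analytic"
  proof -
    have "(\<lambda>z. exp (- herglotz ?u z) * h z) holomorphic_on ball 0 1"
      using h_an hol_u by (auto simp: disk_analytic_def intro!: holomorphic_intros)
    then have "G holomorphic_on ball 0 1"
      by (rule holomorphic_transform) (simp add: G_def singular_inner_fun_cascade_measure)
    then show ?thesis by (simp add: disk_analytic_def G_def h_def)
  qed
  have G_H2: "G \<in> H2" by (rule bounded_disk_analytic_in_H2[OF G_an G_bound])
  have "G = (\<lambda>z. ?\<theta> z * h z)" by (simp add: G_def fun_eq_iff)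
  then have f_H2: "f \<in> H2" and orth: "H2_inner f G = 0"
    using f h_H2 by (auto simp: model_space_def H2_orth_compl_def)
  have "summable (\<lambda>j. taylor_coeff f j * cnj (taylor_coeff G j))"
    by (rule summable_norm_cancel[OF H2_inner_summable[OF f_H2 G_H2]])
  then have orth: "(\<lambda>j. taylor_coeff f j * cnj (taylor_coeff G j)) sums 0"
    using orth by (simp add: H2_inner_def sums_iff)
  have near: "cmod (G (of_real (1 - t) * z) - (of_real (1 - t) * z) ^ k) \<le> 1 / real (Suc n)"
    if z: "cmod z < 1" for z
  proof -
    define w where "w = of_real (1 - t) * z"
    have "cmod w = (1 - t) * cmod z" using t by (simp add: w_def norm_mult del: of_real_diff)
    also have "\<dots> \<le> (1 - t) * 1" using z t by (intro mult_left_mono) auto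
    finally have w: "t \<le> 1 - cmod w" by simp
    then have w1: "cmod w < 1" using t by simp
    have "G w - w ^ k = w ^ k * (?\<theta> w * exp (herglotz ?v w) - 1)"
      using w1 by (simp add: G_def h_def algebra_simps)
    also have "cmod \<dots> \<le> 1 * (1 / real (Suc n))"
      unfolding norm_mult
      by (intro mult_mono power_le w1 exp_herglotz_cascade_near_1[OF t(1) w large]) auto
    finally show ?thesis by (simp add: w_def)
  qed
  have "(1 - t) ^ k * cmod (taylor_coeff f k) \<le> F * (1 / real (Suc n)) + E * exp (fact n)"
  proof (rule coefficient_estimate[where f = f and G = G])
    show "\<And>z. cmod z < 1 \<Longrightarrow> (\<lambda>n. taylor_coeff f n * z ^ n) sums f z"
      using f_H2 by (intro taylor_coeff_sums) (auto simp: H2_def disk_analytic_def)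
    show "\<And>z. cmod z < 1 \<Longrightarrow> (\<lambda>n. taylor_coeff G n * z ^ n) sums G z"
      using G_an by (intro taylor_coeff_sums) (auto simp: disk_analytic_def)
  qed (use t dilate G_bound near F orth in auto)
  moreover have "(1 / 2) ^ k * cmod (taylor_coeff f k) \<le> (1 - t) ^ k * cmod (taylor_coeff f k)"
    using t by (intro mult_right_mono power_mono) auto
  ultimately show ?thesis by linarith
qed

end

section \<open>Choosing the scales and the frequencies\<close>

lemma zero_in_Lambda_a: "(\<lambda>_. 0) \<in> Lambda_a \<omega>"
  unfolding Lambda_a_def disk_analytic_def
  by (auto intro!: exI[of _ "\<lambda>_. 0"] bdd_aboveI[of _ 0])

lemma taylor_coeff_zero [simp]: "taylor_coeff (\<lambda>_. 0) n = 0"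
  by (simp add: taylor_coeff_def)

lemma zero_in_model_space: "(\<lambda>_. 0) \<in> model_space \<theta>"
  by (auto simp: model_space_def H2_orth_compl_def H2_def disk_analytic_def H2_inner_def)

theorem theorem1p3:
  fixes \<omega> :: "real \<Rightarrow> real"
  assumes "modulus_of_continuity \<omega>"
  shows "\<exists>\<theta>. singular_inner \<theta> \<and> Lambda_a \<omega> \<inter> model_space \<theta> = {\<lambda>_. 0}"
proof -
  (* the scale is dictated by the density bound n!, before the frequency N n is chosen *)
  have "\<exists>t. 0 < t \<and> t \<le> 1/2 \<and> \<omega> t \<le> 1 / (real (Suc n) * exp (fact n))" for n
    by (rule modulus_of_continuity_small[OF assms]) simp
  then obtain t where t: "\<And>n. 0 < t n" "\<And>n. t n \<le> 1/2"
    and \<omega>_t: "\<And>n. \<omega> (t n) \<le> 1 / (real (Suc n) * exp (fact n))"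
    by metis
  (* the exponents differ by at most 8 pi / (N n * (t n)^2), so 64 > 16 pi makes this at most 1 / (2 * Suc n) *)
  obtain N where N: "N 0 \<ge> 1" "\<And>n. N (Suc n) \<ge> 2 * Suc n * N n"
    and large: "\<And>n. real (N n) \<ge> 64 * real (Suc n) / (t n)\<^sup>2"
    using ex_lacunary_above[of "\<lambda>n. 64 * real (Suc n) / (t n)\<^sup>2"] by blast
  define \<theta> where "\<theta> = singular_inner_fun (cascade_measure N)"
  have "f = (\<lambda>_. 0)" if f: "f \<in> Lambda_a \<omega>" "f \<in> model_space \<theta>" for f
  proof -
    obtain C where C: "0 \<le> C"
      "\<And>z w. cmod z < 1 \<Longrightarrow> cmod w < 1 \<Longrightarrow> cmod (f z - f w) \<le> C * \<omega> (cmod (z - w))"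
      using Lambda_a_modulus[OF assms f(1)] by blast
    have f_H2: "f \<in> H2" using f(2) by (simp add: model_space_def H2_orth_compl_def)
    then have f_an: "f \<in> disk_analytic" by (simp add: H2_def)
    define F where "F = sqrt (\<Sum>j. (cmod (taylor_coeff f j))\<^sup>2)"
    have F: "(\<Sum>j<m. (cmod (taylor_coeff f j))\<^sup>2) \<le> F\<^sup>2" "0 \<le> F" for m
    proof -
      have "summable (\<lambda>j. (cmod (taylor_coeff f j))\<^sup>2)" using f_H2 by (simp add: H2_def)
      then show "(\<Sum>j<m. (cmod (taylor_coeff f j))\<^sup>2) \<le> F\<^sup>2" "0 \<le> F"
        using sum_le_suminf[of "\<lambda>j. (cmod (taylor_coeff f j))\<^sup>2" "{..<m}"]
        by (auto simp: F_def suminf_nonneg)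
    qed
    have "taylor_coeff f k = 0" for k
    proof -
      have "(1 / 2) ^ k * cmod (taylor_coeff f k) \<le> (F + C) * inverse (real (Suc n))" for n
      proof -
        have dilate: "cmod (f z - f (of_real (1 - t n) * z)) \<le> C * (1 / (real (Suc n) * exp (fact n)))"
          if z: "cmod z < 1" for z
        proof -
          have tz: "t n * cmod z \<le> t n"
            using t[of n] z by (simp add: mult_left_le)
          have "cmod (of_real (1 - t n) * z) \<le> 1 * cmod z"
            unfolding norm_mult norm_of_real using t[of n] by (intro mult_right_mono) auto
          then have "cmod (f z - f (of_real (1 - t n) * z)) \<le> C * \<omega> (cmod (z - of_real (1 - t n) * z))"
            using z by (intro C(2)) auto
          also have "cmod (z - of_real (1 - t n) * z) = t n * cmod z"
          proof -
            have "z - of_real (1 - t n) * z = of_real (t n) * z" by (simp add: algebra_simps)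
            then show ?thesis using t[of n] by (simp add: norm_mult)
          qed
          also have "C * \<omega> (t n * cmod z) \<le> C * \<omega> (t n)"
            using assms t[of n] tz C(1)
            by (intro mult_left_mono) (auto simp: modulus_of_continuity_def mono_on_def)
          also have "\<dots> \<le> C * (1 / (real (Suc n) * exp (fact n)))"
            by (intro mult_left_mono \<omega>_t C(1))
          finally show ?thesis .
        qed
        have "(1 / 2) ^ k * cmod (taylor_coeff f k)
            \<le> F * (1 / real (Suc n)) + C * (1 / (real (Suc n) * exp (fact n))) * exp (fact n)"
          by (rule model_space_coefficient_estimate[OF N f(2)[unfolded \<theta>_def] t large dilate F])
        also have "\<dots> = (F + C) * inverse (real (Suc n))"
          by (simp add: divide_simps)
        finally show ?thesis .
      qed
      then have "(1 / 2) ^ k * cmod (taylor_coeff f k) \<le> 0"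
        by (intro LIMSEQ_le_const[OF tendsto_mult_right_zero[OF LIMSEQ_inverse_real_of_nat]]) blast
      moreover have "(0::real) < (1 / 2) ^ k" by simp
      ultimately show ?thesis
        by (metis mult_le_cancel_left_pos mult_zero_right norm_le_zero_iff)
    qed
    then have "f z = 0" if "cmod z < 1" for z
      using taylor_coeff_sums[of f z] that f_an sums_unique2[OF _ sums_zero]
      by (simp add: disk_analytic_def)
    moreover have "f z = 0" if "\<not> cmod z < 1" for z
      using f_an that by (simp add: disk_analytic_def)
    ultimately show ?thesis by blast
  qed
  then have "Lambda_a \<omega> \<inter> model_space \<theta> = {\<lambda>_. 0}"
    using zero_in_Lambda_a zero_in_model_space by blast
  moreover have "singular_inner \<theta>"
    unfolding \<theta>_def by (rule singular_inner_cascade_measure[OF N])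
  ultimately show ?thesis by blast
qed

end
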